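(* Let $V$ and $V'$ be complex vector spaces in duality, each endowed with the weak topology induced by the duality. If $\boldsymbol{S}=(S_{n,m})_{n,m\in\mathbb{N}}$ is a collection of subsets $S_{n,m}\subset M_{n,m}(V)$, then the rectangular matrix bipolar $\boldsymbol{S}^{\rho\rho}$ is the closed rectangular matrix convex hull of $\boldsymbol{S}$.
   Context: $V$ and $V'$ are in duality via a bilinear map $\langle\cdot,\cdot\rangle:V\times V'\to\mathbb{C}$. A rectangular matrix convex set in a vector space $V$ is a collection $\boldsymbol{K}=(K_{n,m})$ of subsets $K_{n,m}\subset M_{n,m}(V)$ with the property that for any $\alpha_i\in M_{n_i,n}(\mathbb{C})$, $\beta_i\in M_{m_i,m}(\mathbb{C})$ and $v_i\in K_{n_i,m_i}$ for $1\le i\le\ell$ such that $\|\alpha_1^*\alpha_1+\cdots+\alpha_\ell^*\alpha_\ell\|\,\|\beta_1^*\beta_1+\cdots+\beta_\ell^*\beta_\ell\|\le 1$ one has $\alpha_1^*v_1\beta_1+\cdots+\alpha_\ell^*v_\ell\beta_\ell\in K_{n,m}$. It is closed if every $K_{n,m}$ is closed in $M_{n,m}(V)$. The closed rectangular matrix convex hull of $\boldsymbol{S}$ is the smallest closed rectangular matrix convex set containing $\boldsymbol{S}$ (levelwise). For $v=[v_{ij}]\in M_{r,s}(V)$ and $f=[f_{ab}]\in M_{n,m}(V')$ let $\langle\langle v,f\rangle\rangle=[\langle v_{ij},f_{ab}\rangle]\in M_{rn,sm}(\mathbb{C})$, with rows indexed by $(i,a)$ and columns by $(j,b)$. The rectangular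 matrix polar $\boldsymbol{S}^\rho=(S^\rho_{n,m})$ is the closed rectangular matrix convex set in $V'$ such that $f\in M_{n,m}(V')$ belongs to $S^\rho_{n,m}$ if and only if $\|\langle\langle v,f\rangle\rangle\|\le 1$ (operator norm) for every $r,s\in\mathbb{N}$ and every $v\in S_{r,s}$. The bipolar $\boldsymbol{S}^{\rho\rho}$ is the rectangular matrix polar of $\boldsymbol{S}^\rho$, formed in $V$ using the same pairing. *)

theory Defs
  imports
    "HOL-Analysis.Function_Topology"
    "HOL-Analysis.L2_Norm"
    "Jordan_Normal_Form.Schur_Decomposition"
begin

section \<open>Vector spaces in duality\<close>

(* The pairing is an arbitrary bilinear map; it is not required to separate points. *)
locale duality = V: vector_space scaleV + V': vector_space scaleV'
  for scaleV :: "complex \<Rightarrow> 'v::ab_group_add \<Rightarrow> 'v"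
    and scaleV' :: "complex \<Rightarrow> 'w::ab_group_add \<Rightarrow> 'w" +
  fixes pair :: "'v \<Rightarrow> 'w \<Rightarrow> complex"
  assumes linear_left: "Vector_Spaces.linear scaleV (*) (\<lambda>v. pair v w)"
    and linear_right: "Vector_Spaces.linear scaleV' (*) (\<lambda>w. pair v w)"

definition weak_topology :: "('v \<Rightarrow> 'w \<Rightarrow> complex) \<Rightarrow> 'v topology" where
  "weak_topology pair =
     topology_generated_by {{v. pair v w \<in> U} | w U. open U}"

(* M_{n,m}(V), as a product of n * m copies of the weakly topologized space V. *)
definition weak_mat_topology ::
    "('v \<Rightarrow> 'w \<Rightarrow> complex) \<Rightarrow> nat \<Rightarrow> nat \<Rightarrow> 'v mat topology" where
  "weak_mat_topology pair n m =
     pullback_topology (carrier_mat n m)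
       (\<lambda>A. \<lambda>ij\<in>{..<n} \<times> {..<m}. A $$ ij)
       (product_topology (\<lambda>_. weak_topology pair) ({..<n} \<times> {..<m}))"

section \<open>Matrices\<close>

definition vec_l2_norm :: "complex vec \<Rightarrow> real" where
  "vec_l2_norm x = L2_set (\<lambda>i. cmod (x $ i)) {..<dim_vec x}"

definition mat_op_norm :: "complex mat \<Rightarrow> real" where
  "mat_op_norm A =
     (SUP x \<in> {x \<in> carrier_vec (dim_col A). vec_l2_norm x \<le> 1}. vec_l2_norm (A *\<^sub>v x))"

(* The matrix type has no zero of unspecified size, hence is not an instance of the classes
   needed for the sum operator: the size n x m is passed explicitly. *)
definition mat_family_sum ::
    "nat \<Rightarrow> nat \<Rightarrow> nat \<Rightarrow> (nat \<Rightarrow> 'a::comm_monoid_add mat) \<Rightarrow> 'a mat" where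
  "mat_family_sum n m l A = mat n m (\<lambda>(i, j). \<Sum>k<l. A k $$ (i, j))"

(* The product \<alpha>^* v \<beta> of a matrix v over V with scalar matrices. *)
definition mat_compression ::
    "(complex \<Rightarrow> 'v::ab_group_add \<Rightarrow> 'v) \<Rightarrow> complex mat \<Rightarrow> 'v mat \<Rightarrow> complex mat \<Rightarrow> 'v mat" where
  "mat_compression scaleV \<alpha> v \<beta> =
     mat (dim_col \<alpha>) (dim_col \<beta>) (\<lambda>(i, j).
       \<Sum>p<dim_row v. \<Sum>q<dim_col v.
         scaleV (mat_adjoint \<alpha> $$ (i, p) * \<beta> $$ (q, j)) (v $$ (p, q)))"

(* The row index (i, a), with a < dim_row f, is encoded as i * dim_row f + a,
   and likewise for columns. *)
definition mat_pairing ::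
    "('v \<Rightarrow> 'w \<Rightarrow> complex) \<Rightarrow> 'v mat \<Rightarrow> 'w mat \<Rightarrow> complex mat" where
  "mat_pairing pair v f =
     mat (dim_row v * dim_row f) (dim_col v * dim_col f) (\<lambda>(x, y).
       pair (v $$ (x div dim_row f, y div dim_col f)) (f $$ (x mod dim_row f, y mod dim_col f)))"

section \<open>Rectangular matrix convexity\<close>

text \<open>
  A collection \<open>(K\<^sub>n\<^sub>,\<^sub>m)\<close> is indexed by positive integers \<open>n\<close>, \<open>m\<close>; the values of a function
  \<open>K :: nat \<Rightarrow> nat \<Rightarrow> 'v mat set\<close> at \<open>n = 0\<close> or \<open>m = 0\<close> are never used.
\<close>

definition mat_collection :: "(nat \<Rightarrow> nat \<Rightarrow> 'v mat set) \<Rightarrow> bool" where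
  "mat_collection K \<longleftrightarrow> (\<forall>n>0. \<forall>m>0. K n m \<subseteq> carrier_mat n m)"

definition collection_le ::
    "(nat \<Rightarrow> nat \<Rightarrow> 'v mat set) \<Rightarrow> (nat \<Rightarrow> nat \<Rightarrow> 'v mat set) \<Rightarrow> bool" where
  "collection_le S K \<longleftrightarrow> (\<forall>n>0. \<forall>m>0. S n m \<subseteq> K n m)"

(* The number l of summands may be 0, so a rectangular matrix convex set contains the zero
   matrix at every level. This matters only for the collection of empty sets: a nonempty
   member yields the zero matrices through zero coefficients, with l = 1. *)
definition rect_matrix_convex ::
    "(complex \<Rightarrow> 'v::ab_group_add \<Rightarrow> 'v) \<Rightarrow> (nat \<Rightarrow> nat \<Rightarrow> 'v mat set) \<Rightarrow> bool" where
  "rect_matrix_convex scaleV K \<longleftrightarrow>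
     mat_collection K \<and>
     (\<forall>n>0. \<forall>m>0. \<forall>(l::nat) ns ms \<alpha> \<beta> v.
        (\<forall>i<l. ns i > 0 \<and> ms i > 0 \<and>
               \<alpha> i \<in> carrier_mat (ns i) n \<and> \<beta> i \<in> carrier_mat (ms i) m \<and>
               v i \<in> K (ns i) (ms i)) \<and>
        mat_op_norm (mat_family_sum n n l (\<lambda>i. mat_adjoint (\<alpha> i) * \<alpha> i)) *
        mat_op_norm (mat_family_sum m m l (\<lambda>i. mat_adjoint (\<beta> i) * \<beta> i)) \<le> 1 \<longrightarrow>
        mat_family_sum n m l (\<lambda>i. mat_compression scaleV (\<alpha> i) (v i) (\<beta> i)) \<in> K n m)"

definition closed_rect_matrix_convex ::
    "(complex \<Rightarrow> 'v::ab_group_add \<Rightarrow> 'v) \<Rightarrow> ('v \<Rightarrow> 'w \<Rightarrow> complex) \<Rightarrow>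
     (nat \<Rightarrow> nat \<Rightarrow> 'v mat set) \<Rightarrow> bool" where
  "closed_rect_matrix_convex scaleV pair K \<longleftrightarrow>
     rect_matrix_convex scaleV K \<and>
     (\<forall>n>0. \<forall>m>0. closedin (weak_mat_topology pair n m) (K n m))"

definition is_closed_rect_matrix_convex_hull ::
    "(complex \<Rightarrow> 'v::ab_group_add \<Rightarrow> 'v) \<Rightarrow> ('v \<Rightarrow> 'w \<Rightarrow> complex) \<Rightarrow>
     (nat \<Rightarrow> nat \<Rightarrow> 'v mat set) \<Rightarrow> (nat \<Rightarrow> nat \<Rightarrow> 'v mat set) \<Rightarrow> bool" where
  "is_closed_rect_matrix_convex_hull scaleV pair S H \<longleftrightarrow>
     closed_rect_matrix_convex scaleV pair H \<and> collection_le S H \<and>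
     (\<forall>K. closed_rect_matrix_convex scaleV pair K \<and> collection_le S K \<longrightarrow> collection_le H K)"

section \<open>Polars\<close>

definition rect_matrix_polar ::
    "('v \<Rightarrow> 'w \<Rightarrow> complex) \<Rightarrow> (nat \<Rightarrow> nat \<Rightarrow> 'v mat set) \<Rightarrow> nat \<Rightarrow> nat \<Rightarrow> 'w mat set" where
  "rect_matrix_polar pair S n m =
     {f \<in> carrier_mat n m.
        \<forall>r>0. \<forall>s>0. \<forall>v\<in>S r s. mat_op_norm (mat_pairing pair v f) \<le> 1}"

(* The second polar is taken for the same pairing with its arguments exchanged. *)
definition rect_matrix_bipolar ::
    "('v \<Rightarrow> 'w \<Rightarrow> complex) \<Rightarrow> (nat \<Rightarrow> nat \<Rightarrow> 'v mat set) \<Rightarrow> nat \<Rightarrow> nat \<Rightarrow> 'v mat set" where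
  "rect_matrix_bipolar pair S =
     rect_matrix_polar (\<lambda>f v. pair v f) (rect_matrix_polar pair S)"

end

theory Submission
  imports Defs "HOL-Analysis.Convex" "HOL-Library.Function_Algebras"
begin

text \<open>
  By the symmetry of the contractivity of \<open>\<langle>\<langle>v, f\<rangle>\<rangle>\<close> in \<open>v\<close> and \<open>f\<close>, every polar is closed and
  rectangular matrix convex, and \<open>S\<close> lies in its bipolar. Conversely, let \<open>K \<supseteq> S\<close> be closed and
  rectangular matrix convex and \<open>v0 \<notin> K\<^sub>n\<^sub>,\<^sub>m\<close>. Hahn--Banach, applied once to a convex cone, gives a matrix
  \<open>f\<close> over \<open>V'\<close> and positive functionals \<open>\<phi>\<close>, \<open>\<psi>\<close> on the \<open>n \<times> n\<close> and \<open>m \<times> m\<close> matrices such that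
  \<open>Re \<langle>\<alpha>\<^sup>* v \<beta>, f\<rangle> \<le> \<phi>(\<alpha>\<^sup>* \<alpha>) + \<psi>(\<beta>\<^sup>* \<beta>)\<close> for all \<open>v\<close> in \<open>K\<close> and all \<open>\<alpha>\<close>, \<open>\<beta>\<close>, whereas
  \<open>Re \<langle>v0, f\<rangle> > \<phi>(1) + \<psi>(1)\<close>. After a small perturbation \<open>\<phi>(\<alpha>\<^sup>* \<alpha>)\<close> is the squared Hilbert--Schmidt norm of
  \<open>\<alpha>\<close> times an invertible matrix, and likewise for \<open>\<psi>\<close>. Absorbing the inverses of these matrices and a
  factor \<open>1/2\<close> into \<open>f\<close> yields an element of the polar of \<open>K\<close> that is not contractive on \<open>v0\<close>.
\<close>

section \<open>Sublinear functionals and separation of cones\<close>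

definition sublinear :: "('x::real_vector \<Rightarrow> real) \<Rightarrow> bool" where
  "sublinear p \<longleftrightarrow>
     (\<forall>x y. p (x + y) \<le> p x + p y) \<and> (\<forall>t\<ge>0. \<forall>x. p (t *\<^sub>R x) = t * p x)"

lemma sublinear_add: "sublinear p \<Longrightarrow> p (x + y) \<le> p x + p y"
  and sublinear_scaleR: "sublinear p \<Longrightarrow> 0 \<le> t \<Longrightarrow> p (t *\<^sub>R x) = t * p x"
  by (simp_all add: sublinear_def)

lemma sublinear_0: "sublinear p \<Longrightarrow> p 0 = 0"
  using sublinear_scaleR[of p 0 0] by simp

lemma sublinear_minus: "sublinear p \<Longrightarrow> - p x \<le> p (- x)"
  using sublinear_add[of p x "- x"] sublinear_0[of p] by simp

lemma sublinear_sum: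
  assumes p: "sublinear p" and "finite B"
  shows "p (\<Sum>b\<in>B. f b) \<le> (\<Sum>b\<in>B. p (f b))"
  using assms(2)
proof (induction B rule: finite_induct)
  case (insert b B)
  then show ?case using sublinear_add[OF p, of "f b" "\<Sum>b\<in>B. f b"] by simp
qed (simp add: sublinear_0[OF p])

text \<open>
  The construction in Koenig's proof of the Hahn--Banach theorem: \<open>q\<close> is the largest sublinear
  functional below \<open>p\<close> that satisfies \<open>q (- d) \<le> - e\<close> on \<open>D\<close>.
\<close>

lemma sublinear_reduce:
  fixes p :: "'x::real_vector \<Rightarrow> real"
  assumes p: "sublinear p" and D: "convex D" "D \<noteq> {}" and e: "\<And>d. d \<in> D \<Longrightarrow> e \<le> p d"
  obtains q where "sublinear q" "\<And>x. q x \<le> p x" "\<And>d. d \<in> D \<Longrightarrow> q (- d) \<le> - e"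
proof
  \<comment> \<open>\<open>t = 0\<close> gives \<open>q \<le> p\<close>, and \<open>t = 1\<close> at
    \<open>- d\<close> gives the bound on \<open>D\<close>. The shifts \<open>t *\<^sub>R d\<close>
    run over the cone spanned by \<open>D\<close>, which makes the infimum sublinear.\<close>
  define F where "F x = (\<lambda>(t, d). p (x + t *\<^sub>R d) - t * e)" for x
  define I where "I = {0::real..} \<times> D"
  define q where "q x = (INF i\<in>I. F x i)" for x
  have ne: "I \<noteq> {}" using D by (auto simp: I_def)
  \<comment> \<open>This is where the hypothesis \<open>e \<le> p d\<close> enters: it keeps the
    infimum finite. At \<open>x = 0\<close> the same bound yields \<open>q 0 = 0\<close>.\<close>
  have low: "- p (- x) \<le> F x i" if iI: "i \<in> I" for x i
  proof -
    obtain t d where i: "i = (t, d)" "0 \<le> t" "d \<in> D" using iI by (cases i) (auto simp: I_def)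
    have "t * e \<le> t * p d" using e i by (intro mult_left_mono) auto
    also have "\<dots> = p (- x + (x + t *\<^sub>R d))" using i sublinear_scaleR[OF p] by simp
    also have "\<dots> \<le> p (- x) + p (x + t *\<^sub>R d)" by (rule sublinear_add[OF p])
    finally show ?thesis by (simp add: i F_def)
  qed
  have bdd: "bdd_below (F x ` I)" for x using low[of _ x] by (intro bdd_belowI2)
  have q_le: "q x \<le> F x i" if "i \<in> I" for x i
    unfolding q_def using bdd that by (rule cINF_lower)
  have q_ge: "c \<le> q x" if "\<And>i. i \<in> I \<Longrightarrow> c \<le> F x i" for c x
    unfolding q_def using ne that by (rule cINF_greatest)
  obtain d0 where d0: "d0 \<in> D" using D by auto
  show qp: "q x \<le> p x" for x
    using q_le[of "(0, d0)" x] d0 by (simp add: I_def F_def)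
  show "q (- d) \<le> - e" if "d \<in> D" for d
    using q_le[of "(1, d)" "- d"] that sublinear_0[OF p] by (simp add: I_def F_def)
  have add: "q (x + y) \<le> q x + q y" for x y
  proof -
    have step: "q (x + y) \<le> F x i + F y j" if ij: "i \<in> I" "j \<in> I" for i j
    proof -
      obtain t d s c where i: "i = (t, d)" "0 \<le> t" "d \<in> D" and j: "j = (s, c)" "0 \<le> s" "c \<in> D"
        using ij by (cases i; cases j) (auto simp: I_def)
      show ?thesis
      proof (cases "t + s = 0")
        case True
        then have "t = 0" "s = 0" using i j by auto
        then show ?thesis using qp[of "x + y"] sublinear_add[OF p, of x y] i j by (simp add: F_def)
      next
        case False
        \<comment> \<open>Convexity of \<open>D\<close> merges the two shifts:
          \<open>t *\<^sub>R d + s *\<^sub>R c\<close> is \<open>t + s\<close> times a point of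
          \<open>D\<close>, so \<open>(t + s, m)\<close> competes in the infimum at
          \<open>x + y\<close>.\<close>
        define m where "m = (t / (t + s)) *\<^sub>R d + (s / (t + s)) *\<^sub>R c"
        have m: "m \<in> D" unfolding m_def
          using i j False by (intro convexD[OF D(1)]) (auto simp: add_divide_distrib[symmetric])
        have ts: "(t + s) *\<^sub>R m = t *\<^sub>R d + s *\<^sub>R c"
          using False by (simp add: m_def scaleR_add_right)
        have "x + y + (t + s) *\<^sub>R m = (x + t *\<^sub>R d) + (y + s *\<^sub>R c)"
          unfolding ts by (simp add: ac_simps)
        then have "F (x + y) (t + s, m) = p ((x + t *\<^sub>R d) + (y + s *\<^sub>R c)) - (t + s) * e"
          by (simp only: F_def case_prod_conv)
        moreover have "q (x + y) \<le> F (x + y) (t + s, m)" using i j m by (intro q_le) (auto simp: I_def)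
        moreover have "p ((x + t *\<^sub>R d) + (y + s *\<^sub>R c)) - (t + s) * e \<le> F x i + F y j"
          using sublinear_add[OF p, of "x + t *\<^sub>R d" "y + s *\<^sub>R c"] i j
          by (simp add: F_def algebra_simps)
        ultimately show ?thesis by simp
      qed
    qed
    have "q (x + y) - F x i \<le> q y" if "i \<in> I" for i
      using step[OF that] by (intro q_ge) (simp add: algebra_simps)
    then have "q (x + y) - q y \<le> q x" by (intro q_ge) (simp add: algebra_simps)
    then show ?thesis by simp
  qed
  have scale_le: "q (t *\<^sub>R x) \<le> t * q x" if t: "0 < t" for t x
  proof -
    have "q (t *\<^sub>R x) / t \<le> F x i" if iI: "i \<in> I" for i
    proof -
      obtain s d where i: "i = (s, d)" "0 \<le> s" "d \<in> D" using iI by (cases i) (auto simp: I_def)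
      have "q (t *\<^sub>R x) \<le> F (t *\<^sub>R x) (t * s, d)" using i t by (intro q_le) (auto simp: I_def)
      also have "\<dots> = p (t *\<^sub>R (x + s *\<^sub>R d)) - t * s * e" by (simp add: F_def scaleR_add_right)
      also have "\<dots> = t * F x i" 
        using t i sublinear_scaleR[OF p, of t "x + s *\<^sub>R d"]
        by (simp add: F_def right_diff_distrib mult.assoc)
      finally show ?thesis using t by (simp add: field_simps)
    qed
    then have "q (t *\<^sub>R x) / t \<le> q x" by (rule q_ge)
    then show ?thesis using t by (simp add: field_simps)
  qed
  have q0: "q 0 = 0"
    using qp[of 0] low[of _ 0] sublinear_0[OF p] by (intro antisym q_ge) auto
  have scale: "q (t *\<^sub>R x) = t * q x" if "0 \<le> t" for t x
  proof (cases "t = 0")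
    case False
    then have "0 < t" using that by simp
    then show ?thesis using scale_le[of t x] scale_le[of "1 / t" "t *\<^sub>R x"] by (simp add: field_simps)
  qed (simp add: q0)
  show "sublinear q" by (simp add: sublinear_def add scale)
qed

text \<open>A finite form of Hahn-Banach. Reducing by the singleton \<open>{a}\<close> at level
  \<open>q a\<close> makes the functional odd at \<open>a\<close>. Oddness already attained at
  \<open>b\<close> survives, because
  \<open>- q' b \<le> q' (- b) \<le> q (- b) = - q b \<le> - q' b\<close>.\<close>

lemma sublinear_reduce_odd:
  fixes p :: "'x::real_vector \<Rightarrow> real"
  assumes "finite B" and "sublinear p"
  obtains q where "sublinear q" "\<And>x. q x \<le> p x" "\<And>b. b \<in> B \<Longrightarrow> q (- b) = - q b"
proof -
  have "\<exists>q. sublinear q \<and> (\<forall>x. q x \<le> p x) \<and> (\<forall>b\<in>B. q (- b) = - q b)"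
    using assms(1)
  proof (induction B rule: finite_induct)
    case empty
    then show ?case using assms(2) by auto
  next
    case (insert a B)
    then obtain q where q: "sublinear q" "\<And>x. q x \<le> p x" "\<And>b. b \<in> B \<Longrightarrow> q (- b) = - q b"
      by blast
    obtain q' where q': "sublinear q'" "\<And>x. q' x \<le> q x" "q' (- a) \<le> - q a"
      by (rule sublinear_reduce[OF q(1), of "{a}" "q a"]) auto
    have "q' (- b) = - q' b" if "b \<in> insert a B" for b
    proof (rule antisym)
      show "q' (- b) \<le> - q' b"
        using that q'(2)[of b] q'(2)[of "- b"] q'(3) q(3)[of b] sublinear_minus[OF q'(1), of "b"]
          sublinear_minus[OF q'(1), of "- b"]
        by (auto)
      show "- q' b \<le> q' (- b)" by (rule sublinear_minus[OF q'(1)])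
    qed
    moreover have "q' x \<le> p x" for x using q'(2) q(2) by (rule order_trans)
    ultimately show ?case using q'(1) by blast
  qed
  then show thesis using that by blast
qed

text \<open>Oddness extends positive homogeneity to negative scalars; subadditivity for the
  combination and for its negative then gives both inequalities.\<close>

lemma sublinear_linear_combination:
  fixes q :: "'x::real_vector \<Rightarrow> real"
  assumes q: "sublinear q" and B: "finite B" and odd: "\<And>b. b \<in> B \<Longrightarrow> q (- f b) = - q (f b)"
  shows "q (\<Sum>b\<in>B. r b *\<^sub>R f b) = (\<Sum>b\<in>B. r b * q (f b))"
proof -
  have s: "q (r *\<^sub>R f b) = r * q (f b)" if "b \<in> B" for r b
  proof (cases "0 \<le> r")
    case False
    then show ?thesis using sublinear_scaleR[OF q, of "- r" "- f b"] odd[OF that] by simp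
  qed (simp add: sublinear_scaleR[OF q])
  have "q (\<Sum>b\<in>B. r b *\<^sub>R f b) \<le> (\<Sum>b\<in>B. r b * q (f b))" for r
    using sublinear_sum[OF q B, of "\<lambda>b. r b *\<^sub>R f b"] s by simp
  from this[of r] this[of "\<lambda>b. - r b"] show ?thesis
    using sublinear_minus[OF q, of "\<Sum>b\<in>B. r b *\<^sub>R f b"] by (simp add: sum_negf)
qed

text \<open>Functions with pointwise operations are the ambient real vector space of the cones; in
  \<open>cone_separation\<close> only the finitely many coordinates in \<open>J\<close> are
  measured.\<close>

instantiation "fun" :: (type, real_vector) real_vector
begin

definition scaleR_fun_def: "r *\<^sub>R f = (\<lambda>x. r *\<^sub>R f x)"

instance
  by standard (simp_all add: scaleR_fun_def fun_eq_iff scaleR_add_left scaleR_add_right)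

end

lemma scaleR_fun_apply [simp]: "(r *\<^sub>R f) x = r *\<^sub>R f x"
  by (simp add: scaleR_fun_def)

lemma sum_fun_apply: "(\<Sum>i\<in>I. f i) x = (\<Sum>i\<in>I. f i x)"
  by (induction I rule: infinite_finite_induct) simp_all

text \<open>In the l1 seminorm on \<open>J\<close>, the point \<open>x\<close> has distance at least
  \<open>\<epsilon>\<close> from \<open>C\<close>. Reducing this seminorm along \<open>C - x\<close>
  and making the result odd on the coordinate vectors yields a real linear functional with
  \<open>\<epsilon> \<le> q c - q x\<close> on \<open>C\<close>. Closure under scaling turns this
  lower bound into nonnegativity on \<open>C\<close>.\<close>

lemma cone_separation:
  fixes C :: "('i \<Rightarrow> complex) set" and x :: "'i \<Rightarrow> complex"
  assumes J: "finite J"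
    and C0: "0 \<in> C" and C_add: "\<And>c d. c \<in> C \<Longrightarrow> d \<in> C \<Longrightarrow> c + d \<in> C"
    and C_scale: "\<And>t c. 0 < t \<Longrightarrow> c \<in> C \<Longrightarrow> t *\<^sub>R c \<in> C"
    and gap: "0 < \<epsilon>" "\<And>c. c \<in> C \<Longrightarrow> \<epsilon> \<le> (\<Sum>j\<in>J. cmod (c j - x j))"
  obtains a where "\<And>c. c \<in> C \<Longrightarrow> 0 \<le> Re (\<Sum>j\<in>J. a j * c j)" "Re (\<Sum>j\<in>J. a j * x j) < 0"
proof -
  define p where "p y = (\<Sum>j\<in>J. cmod (y j))" for y :: "'i \<Rightarrow> complex"
  have p: "sublinear p"
    unfolding sublinear_def p_def
  proof (intro conjI allI impI)
    fix y z :: "'i \<Rightarrow> complex" and t :: real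
    show "(\<Sum>j\<in>J. cmod ((y + z) j)) \<le> (\<Sum>j\<in>J. cmod (y j)) + (\<Sum>j\<in>J. cmod (z j))"
      unfolding sum.distrib[symmetric] plus_fun_apply by (intro sum_mono norm_triangle_ineq)
    assume "0 \<le> t"
    then show "(\<Sum>j\<in>J. cmod ((t *\<^sub>R y) j)) = t * (\<Sum>j\<in>J. cmod (y j))"
      by (simp add: sum_distrib_left[symmetric])
  qed
  define D where "D = (\<lambda>c. c - x) ` C"
  have "convex C"
    unfolding convex_alt
  proof (intro ballI allI impI)
    fix c d :: "'i \<Rightarrow> complex" and u :: real
    assume "c \<in> C" "d \<in> C" "0 \<le> u \<and> u \<le> 1"
    then show "(1 - u) *\<^sub>R c + u *\<^sub>R d \<in> C"
      using C_add[OF C_scale[of "1 - u" c] C_scale[of u d]] by (cases "u = 0 \<or> u = 1") auto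
  qed
  then have D: "convex D" "D \<noteq> {}" using C0 unfolding D_def by (simp_all only: convex_translation_subtract) blast
  have "\<epsilon> \<le> p d" if "d \<in> D" for d
  proof -
    obtain c where "c \<in> C" "d = c - x" using \<open>d \<in> D\<close> unfolding D_def by blast
    then show ?thesis using gap(2)[of c] by (simp add: p_def)
  qed
  then obtain p' where p': "sublinear p'" "\<And>y. p' y \<le> p y" "\<And>d. d \<in> D \<Longrightarrow> p' (- d) \<le> - \<epsilon>"
    using sublinear_reduce[OF p D, of \<epsilon>] by blast
  \<comment> \<open>The vectors \<open>e (j, 1)\<close> and \<open>e (j, \<i>)\<close> form a real
    basis of the coordinates in \<open>J\<close>.\<close>
  define e where "e = (\<lambda>(j, z) k :: 'i. if k = j then z else 0 :: complex)"
  define B where "B = J \<times> {1, \<i>}"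
  have B: "finite (e ` B)" "finite B" using J by (auto simp: B_def)
  obtain q where q: "sublinear q" "\<And>y. q y \<le> p' y" "\<And>b. b \<in> e ` B \<Longrightarrow> q (- b) = - q b"
    using sublinear_reduce_odd[OF B(1) p'(1)] by blast
  \<comment> \<open>The functional is only real linear. These coefficients make it the real part of
    a complex linear one, since \<open>Re ((u - \<i> * v) * z) = u * Re z + v * Im z\<close> for
    real \<open>u\<close> and \<open>v\<close>.\<close>
  define a where "a j = Complex (q (e (j, 1))) (- q (e (j, \<i>)))" for j
  have q_eq: "q y = Re (\<Sum>j\<in>J. a j * y j)" for y
  proof -
    define r where "r = (\<lambda>(j, z :: complex). if z = 1 then Re (y j) else Im (y j))"
    define y' where "y' = (\<Sum>b\<in>B. r b *\<^sub>R e b)"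
    have y'_eq: "y' k = (\<Sum>j\<in>J. if k = j then y j else 0)" for k
      unfolding y'_def B_def sum_fun_apply
      unfolding sum.cartesian_product'
      by (intro sum.cong) (simp_all add: r_def e_def complex_eq_iff)
    have y': "y' k = y k" if "k \<in> J" for k using J that by (simp add: y'_eq)
    \<comment> \<open>\<open>p\<close> vanishes on whatever is zero on \<open>J\<close>, so
      \<open>q\<close> cannot distinguish \<open>y\<close> from its expansion in the basis.\<close>
    have "p (y - y') = 0" "p (y' - y) = 0" by (auto simp: p_def y')
    then have "q (y - y') \<le> 0" "q (y' - y) \<le> 0"
      using q(2)[of "y - y'"] p'(2)[of "y - y'"] q(2)[of "y' - y"] p'(2)[of "y' - y"] by linarith+
    then have "q y = q y'"
      using sublinear_add[OF q(1), of "y - y'" y'] sublinear_add[OF q(1), of "y' - y" y] by simp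
    also have "\<dots> = (\<Sum>b\<in>B. r b * q (e b))"
      unfolding y'_def using q(3) by (intro sublinear_linear_combination[OF q(1) B(2)]) auto
    also have "\<dots> = (\<Sum>j\<in>J. \<Sum>z\<in>{1, \<i>}. r (j, z) * q (e (j, z)))"
      unfolding B_def by (rule sum.cartesian_product')
    also have "\<dots> = Re (\<Sum>j\<in>J. a j * y j)"
      by (simp add: r_def a_def complex_eq_iff algebra_simps)
    finally show ?thesis .
  qed
  have sep: "\<epsilon> \<le> q c - q x" if "c \<in> C" for c
  proof -
    have "c - x \<in> D" using that by (simp add: D_def)
    then have "q (- (c - x)) \<le> - \<epsilon>" using q(2) p'(3) by (meson order_trans)
    moreover have "q (- (c - x)) = q x - q c"
      by (simp add: q_eq algebra_simps sum_subtractf)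
    ultimately show ?thesis by simp
  qed
  show thesis
  proof
    show "Re (\<Sum>j\<in>J. a j * x j) < 0"
      unfolding q_eq[symmetric] using sep[OF C0] gap(1) sublinear_0[OF q(1)] by linarith
    fix c assume c: "c \<in> C"
    show "0 \<le> Re (\<Sum>j\<in>J. a j * c j)"
    proof (rule ccontr)
      assume "\<not> ?thesis"
      then have neg: "q c < 0" unfolding q_eq[symmetric] by simp
      \<comment> \<open>Chosen so that \<open>t * q c = - (1 + \<bar>q x\<bar>)\<close>, which is
        too low for the bound \<open>\<epsilon> \<le> q (t *\<^sub>R c) - q x\<close>.\<close>
      define t where "t = (1 + \<bar>q x\<bar>) / - q c"
      have "0 < t" using neg by (simp add: t_def field_simps)
      then have "\<epsilon> \<le> t * q c - q x"
        using sep[OF C_scale[OF _ c], of t] sublinear_scaleR[OF q(1), of t c] by simp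
      also have "t * q c = - (1 + \<bar>q x\<bar>)" using neg by (simp add: t_def field_simps)
      finally show False using gap(1) by linarith
    qed
  qed
qed

section \<open>Operator norms as sesquilinear estimates\<close>

text \<open>Vectors are plain functions here: only the values below \<open>n\<close> count, and
  reindexing carries no carrier conditions.\<close>

definition sq_norm :: "nat \<Rightarrow> (nat \<Rightarrow> complex) \<Rightarrow> real" where
  "sq_norm n x = (\<Sum>i<n. (cmod (x i))\<^sup>2)"

definition mat_form :: "complex mat \<Rightarrow> (nat \<Rightarrow> complex) \<Rightarrow> (nat \<Rightarrow> complex) \<Rightarrow> complex" where
  "mat_form A y x = (\<Sum>i<dim_row A. \<Sum>j<dim_col A. cnj (y i) * A $$ (i, j) * x j)"

lemma sq_norm_nonneg: "0 \<le> sq_norm n x"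
  by (simp add: sq_norm_def sum_nonneg)

lemma L2_set_cmod_squared: "(L2_set (\<lambda>i. cmod (x i)) {..<n})\<^sup>2 = sq_norm n x"
  by (simp add: L2_set_def sq_norm_def sum_nonneg)

lemma mult_mat_vec_sum:
  "i < dim_row A \<Longrightarrow> dim_vec x = dim_col A \<Longrightarrow> (A *\<^sub>v x) $ i = (\<Sum>j<dim_col A. A $$ (i, j) * x $ j)"
  by (simp add: scalar_prod_def lessThan_atLeast0)

lemma mat_form_mult_mat_vec:
  "mat_form A y x = (\<Sum>i<dim_row A. cnj (y i) * (A *\<^sub>v vec (dim_col A) x) $ i)"
  unfolding mat_form_def
  by (intro sum.cong) (simp_all add: mult_mat_vec_sum sum_distrib_left mult.assoc del: index_mult_mat_vec)

lemma vec_l2_norm_smult: "vec_l2_norm (c \<cdot>\<^sub>v x) = cmod c * vec_l2_norm x"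
  by (auto simp: vec_l2_norm_def norm_mult L2_set_right_distrib intro!: L2_set_cong)

lemma vec_l2_norm_0 [simp]: "vec_l2_norm (0\<^sub>v n) = 0"
  by (simp add: vec_l2_norm_def L2_set_eq_0_iff)

lemma vec_l2_norm_nonneg: "0 \<le> vec_l2_norm x"
  by (simp add: vec_l2_norm_def L2_set_nonneg)

text \<open>Boundedness is what makes the real supremum in \<open>mat_op_norm\<close> an upper
  bound; the sum of the moduli of all entries serves as the bound.\<close>

lemma vec_l2_norm_mult_bdd:
  "bdd_above ((\<lambda>x. vec_l2_norm (A *\<^sub>v x)) ` {x \<in> carrier_vec (dim_col A). vec_l2_norm x \<le> 1})"
proof (intro bdd_aboveI2)
  fix x assume "x \<in> {x \<in> carrier_vec (dim_col A). vec_l2_norm x \<le> 1}"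
  then have x: "dim_vec x = dim_col A" "vec_l2_norm x \<le> 1" by auto
  have entry: "cmod (x $ j) \<le> 1" if "j < dim_col A" for j
    using member_le_L2_set[of "{..<dim_vec x}" j "\<lambda>i. cmod (x $ i)"] that x
    by (simp add: vec_l2_norm_def)
  have "vec_l2_norm (A *\<^sub>v x) \<le> (\<Sum>i<dim_row A. cmod ((A *\<^sub>v x) $ i))"
    using L2_set_le_sum[of "{..<dim_row A}" "\<lambda>i. cmod ((A *\<^sub>v x) $ i)"]
    by (simp add: vec_l2_norm_def)
  also have "\<dots> \<le> (\<Sum>i<dim_row A. \<Sum>j<dim_col A. cmod (A $$ (i, j)))"
  proof (intro sum_mono)
    fix i assume "i \<in> {..<dim_row A}"
    then have "cmod ((A *\<^sub>v x) $ i) \<le> (\<Sum>j<dim_col A. cmod (A $$ (i, j) * x $ j))"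
      using x by (simp add: mult_mat_vec_sum norm_sum del: index_mult_mat_vec)
    also have "\<dots> \<le> (\<Sum>j<dim_col A. cmod (A $$ (i, j)))"
      using entry by (intro sum_mono) (simp add: norm_mult mult_left_le)
    finally show "cmod ((A *\<^sub>v x) $ i) \<le> (\<Sum>j<dim_col A. cmod (A $$ (i, j)))" .
  qed
  finally show "vec_l2_norm (A *\<^sub>v x) \<le> (\<Sum>i<dim_row A. \<Sum>j<dim_col A. cmod (A $$ (i, j)))" .
qed

lemma vec_l2_norm_mult_le:
  assumes x: "x \<in> carrier_vec (dim_col A)"
  shows "vec_l2_norm (A *\<^sub>v x) \<le> mat_op_norm A * vec_l2_norm x"
proof (cases "vec_l2_norm x = 0")
  case True
  then have "L2_set (\<lambda>i. cmod (x $ i)) {..<dim_col A} = 0" using x by (simp add: vec_l2_norm_def)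
  then have "\<forall>i<dim_col A. x $ i = 0" by (simp add: L2_set_eq_0_iff)
  then have "x = 0\<^sub>v (dim_col A)" using x by auto
  then have "A *\<^sub>v x = 0\<^sub>v (dim_row A)" by auto
  then show ?thesis using True by simp
next
  case False
  define c where "c = complex_of_real (1 / vec_l2_norm x)"
  have pos: "0 < vec_l2_norm x" using False vec_l2_norm_nonneg[of x] by simp
  have c: "cmod c = 1 / vec_l2_norm x" using pos by (simp add: c_def norm_divide)
  have "vec_l2_norm (A *\<^sub>v (c \<cdot>\<^sub>v x)) \<le> mat_op_norm A"
    unfolding mat_op_norm_def using x pos
    by (intro cSUP_upper vec_l2_norm_mult_bdd) (simp add: vec_l2_norm_smult c)
  also have "A *\<^sub>v (c \<cdot>\<^sub>v x) = c \<cdot>\<^sub>v (A *\<^sub>v x)"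
    using x by (intro mult_mat_vec) auto
  finally show ?thesis using pos by (simp add: vec_l2_norm_smult c field_simps)
qed

lemma mat_op_norm_nonneg: "0 \<le> mat_op_norm A"
proof -
  have "vec_l2_norm (A *\<^sub>v 0\<^sub>v (dim_col A)) \<le> mat_op_norm A"
    unfolding mat_op_norm_def by (intro cSUP_upper vec_l2_norm_mult_bdd) simp
  then show ?thesis using vec_l2_norm_nonneg order_trans by blast
qed

lemma Re_mat_form_le:
  \<comment> \<open>Cauchy-Schwarz, followed by the inequality of arithmetic and geometric means.
    The arithmetic-mean form is additive over families of vectors, unlike a product of
    norms.\<close>
  "Re (mat_form A y x) \<le> mat_op_norm A * ((sq_norm (dim_row A) y + sq_norm (dim_col A) x) / 2)"
proof -
  define v where "v = vec (dim_col A) x"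
  define a b where "a = L2_set (\<lambda>i. cmod (y i)) {..<dim_row A}"
    and "b = L2_set (\<lambda>i. cmod (x i)) {..<dim_col A}"
  have b: "vec_l2_norm v = b" unfolding vec_l2_norm_def b_def v_def by (intro L2_set_cong) auto
  have "Re (mat_form A y x) \<le> cmod (mat_form A y x)" by (rule complex_Re_le_cmod)
  also have "\<dots> \<le> (\<Sum>i<dim_row A. \<bar>cmod (y i)\<bar> * \<bar>cmod ((A *\<^sub>v v) $ i)\<bar>)"
    unfolding mat_form_mult_mat_vec v_def[symmetric] by (rule order_trans[OF norm_sum]) (simp add: norm_mult)
  also have "\<dots> \<le> a * vec_l2_norm (A *\<^sub>v v)"
    unfolding a_def vec_l2_norm_def dim_mult_mat_vec by (rule L2_set_mult_ineq)
  also have "\<dots> \<le> a * (mat_op_norm A * b)"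
    unfolding b[symmetric] by (intro mult_left_mono vec_l2_norm_mult_le) (auto simp: a_def v_def L2_set_nonneg)
  also have "\<dots> = mat_op_norm A * (a * b)" by simp
  also have "\<dots> \<le> mat_op_norm A * ((a\<^sup>2 + b\<^sup>2) / 2)"
    using sum_squares_bound[of a b] by (intro mult_left_mono mat_op_norm_nonneg) simp
  finally show ?thesis by (simp add: a_def b_def L2_set_cmod_squared)
qed

text \<open>Contractions can thus be handled as quadratic inequalities. For the converse, taking
  \<open>y\<close> to be the image of \<open>x\<close> turns the left side into the squared norm of
  \<open>y\<close>, half of which is absorbed from the right.\<close>

lemma mat_op_norm_le_1_iff:
  "mat_op_norm A \<le> 1 \<longleftrightarrow>
     (\<forall>y x. Re (mat_form A y x) \<le> (sq_norm (dim_row A) y + sq_norm (dim_col A) x) / 2)"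
proof (intro iffI allI)
  fix y x assume A: "mat_op_norm A \<le> 1"
  define s where "s = (sq_norm (dim_row A) y + sq_norm (dim_col A) x) / 2"
  have "0 \<le> s" by (simp add: s_def sq_norm_nonneg)
  then have "mat_op_norm A * s \<le> 1 * s" using A by (intro mult_right_mono)
  then show "Re (mat_form A y x) \<le> (sq_norm (dim_row A) y + sq_norm (dim_col A) x) / 2"
    using Re_mat_form_le[of A y x] by (simp add: s_def)
next
  assume *: "\<forall>y x. Re (mat_form A y x) \<le> (sq_norm (dim_row A) y + sq_norm (dim_col A) x) / 2"
  show "mat_op_norm A \<le> 1"
    unfolding mat_op_norm_def
  proof (rule cSUP_least)
    have "0\<^sub>v (dim_col A) \<in> {x \<in> carrier_vec (dim_col A). vec_l2_norm x \<le> 1}"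
      by simp
    then show "{x \<in> carrier_vec (dim_col A). vec_l2_norm x \<le> 1} \<noteq> {}" by blast
    fix x assume "x \<in> {x \<in> carrier_vec (dim_col A). vec_l2_norm x \<le> 1}"
    then have x: "x \<in> carrier_vec (dim_col A)" "vec_l2_norm x \<le> 1" by auto
    define y where "y = A *\<^sub>v x"
    have v: "vec (dim_col A) (($) x) = x" using x by auto
    have "mat_form A (($) y) (($) x) = (\<Sum>i<dim_row A. complex_of_real ((cmod (y $ i))\<^sup>2))"
      unfolding mat_form_mult_mat_vec v y_def[symmetric]
      by (intro sum.cong refl) (subst complex_norm_square, rule mult.commute)
    then have "Re (mat_form A (($) y) (($) x)) = sq_norm (dim_row A) (($) y)"
      by (simp add: sq_norm_def)
    then have "sq_norm (dim_row A) (($) y) \<le> sq_norm (dim_col A) (($) x)"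
      using *[rule_format, of "($) y" "($) x"] by simp
    moreover have "(vec_l2_norm y)\<^sup>2 = sq_norm (dim_row A) (($) y)"
      by (simp add: vec_l2_norm_def L2_set_cmod_squared y_def del: index_mult_mat_vec)
    moreover have "(vec_l2_norm x)\<^sup>2 = sq_norm (dim_col A) (($) x)"
      using x by (simp add: vec_l2_norm_def L2_set_cmod_squared)
    ultimately have "vec_l2_norm y \<le> vec_l2_norm x"
      using vec_l2_norm_nonneg by (metis power2_le_imp_le)
    then show "vec_l2_norm (A *\<^sub>v x) \<le> 1" using x by (simp add: y_def)
  qed
qed

section \<open>Contractivity of the pairing matrix as a sesquilinear estimate\<close>

definition sq_norm2 :: "nat \<Rightarrow> nat \<Rightarrow> (nat \<Rightarrow> nat \<Rightarrow> complex) \<Rightarrow> real" where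
  "sq_norm2 r n x = (\<Sum>p<r. \<Sum>a<n. (cmod (x p a))\<^sup>2)"

text \<open>The sesquilinear form of \<open>mat_pairing\<close>, with each index pair kept as two
  indices instead of being encoded in one number.\<close>

definition pairing_form ::
    "('v \<Rightarrow> 'w \<Rightarrow> complex) \<Rightarrow> 'v mat \<Rightarrow> 'w mat \<Rightarrow>
     (nat \<Rightarrow> nat \<Rightarrow> complex) \<Rightarrow> (nat \<Rightarrow> nat \<Rightarrow> complex) \<Rightarrow> complex" where
  "pairing_form pair v f y x =
     (\<Sum>p<dim_row v. \<Sum>a<dim_row f. \<Sum>q<dim_col v. \<Sum>b<dim_col f.
        cnj (y p a) * pair (v $$ (p, q)) (f $$ (a, b)) * x q b)"

definition pairing_contractive :: "('v \<Rightarrow> 'w \<Rightarrow> complex) \<Rightarrow> 'v mat \<Rightarrow> 'w mat \<Rightarrow> bool" where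
  "pairing_contractive pair v f \<longleftrightarrow>
     (\<forall>y x. Re (pairing_form pair v f y x) \<le>
        (sq_norm2 (dim_row v) (dim_row f) y + sq_norm2 (dim_col v) (dim_col f) x) / 2)"

lemma sum_lessThan_mult:
  fixes g :: "nat \<Rightarrow> 'a::comm_monoid_add"
  shows "(\<Sum>i<r * n. g i) = (\<Sum>p<r. \<Sum>a<n. g (p * n + a))"
proof -
  have "(\<Sum>i\<in>{p * n..<p * n + n}. g i) = (\<Sum>a<n. g (p * n + a))" for p
    using sum.shift_bounds_nat_ivl[of g 0 "p * n" n] by (simp add: lessThan_atLeast0 add.commute)
  then show ?thesis unfolding sum.nat_group[of g n r, symmetric] by simp
qed

lemma mat_form_mat_pairing:
  "mat_form (mat_pairing pair v f) y x =
     pairing_form pair v f (\<lambda>p a. y (p * dim_row f + a)) (\<lambda>q b. x (q * dim_col f + b))"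
proof -
  have lt: "p * n + a < r * n" if "p < r" "a < n" for p a r n :: nat
  proof -
    have "p * n + a < Suc p * n" using that by simp
    also have "\<dots> \<le> r * n" using that by (intro mult_le_mono1) simp
    finally show ?thesis .
  qed
  show ?thesis
    unfolding mat_form_def pairing_form_def mat_pairing_def
    by (simp add: sum_lessThan_mult lt)
qed

lemma mat_op_norm_mat_pairing_le_1_iff:
  assumes "0 < dim_row f" "0 < dim_col f"
  shows "mat_op_norm (mat_pairing pair v f) \<le> 1 \<longleftrightarrow> pairing_contractive pair v f"
proof -
  have dims: "dim_row (mat_pairing pair v f) = dim_row v * dim_row f"
    "dim_col (mat_pairing pair v f) = dim_col v * dim_col f"
    by (simp_all add: mat_pairing_def)
  have sq: "sq_norm (r * n) y = sq_norm2 r n (\<lambda>p a. y (p * n + a))" for r n y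
    by (simp add: sq_norm_def sq_norm2_def sum_lessThan_mult)
  have "pairing_contractive pair v f"
    if *: "\<forall>y x. Re (mat_form (mat_pairing pair v f) y x) \<le>
       (sq_norm (dim_row v * dim_row f) y + sq_norm (dim_col v * dim_col f) x) / 2"
    unfolding pairing_contractive_def
  proof (intro allI)
    fix y x
    \<comment> \<open>Every array comes from a vector: flattening by \<open>div\<close> and
      \<open>mod\<close> is undone by reading off the entry at
      \<open>p * dim_row f + a\<close>.\<close>
    show "Re (pairing_form pair v f y x) \<le>
        (sq_norm2 (dim_row v) (dim_row f) y + sq_norm2 (dim_col v) (dim_col f) x) / 2"
      using *[rule_format, of "\<lambda>i. y (i div dim_row f) (i mod dim_row f)"
          "\<lambda>j. x (j div dim_col f) (j mod dim_col f)"] assms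
      by (simp add: mat_form_mat_pairing sq pairing_form_def sq_norm2_def)
  qed
  moreover have "\<forall>y x. Re (mat_form (mat_pairing pair v f) y x) \<le>
       (sq_norm (dim_row v * dim_row f) y + sq_norm (dim_col v * dim_col f) x) / 2"
    if "pairing_contractive pair v f"
    using that unfolding mat_form_mat_pairing sq pairing_contractive_def by blast
  ultimately show ?thesis
    unfolding mat_op_norm_le_1_iff dims by blast
qed

text \<open>Exchanging \<open>v\<close> and \<open>f\<close> only transposes the test arrays, which
  preserves their Hilbert-Schmidt norms. Polars for the exchanged pairing can therefore be described
  by the original one.\<close>

lemma pairing_contractive_swap:
  "pairing_contractive (\<lambda>f v. pair v f) f v \<longleftrightarrow> pairing_contractive pair v f"
proof -
  have form: "pairing_form (\<lambda>f v. pair v f) f v y x =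
      pairing_form pair v f (\<lambda>p a. y a p) (\<lambda>q b. x b q)"
    for pair :: "'c \<Rightarrow> 'd \<Rightarrow> complex" and v f y x
    unfolding pairing_form_def
    by (rule trans[OF sum.swap], rule sum.cong[OF refl], rule sum.cong[OF refl], rule sum.swap)
  have sq: "sq_norm2 n r y = sq_norm2 r n (\<lambda>p a. y a p)" for n r y
    unfolding sq_norm2_def by (rule sum.swap)
  have half: "pairing_contractive (\<lambda>f v. pair v f) f v"
    if "pairing_contractive pair v f" for pair :: "'c \<Rightarrow> 'd \<Rightarrow> complex" and v f
    unfolding pairing_contractive_def
  proof (intro allI)
    fix y x
    show "Re (pairing_form (\<lambda>f v. pair v f) f v y x) \<le>
        (sq_norm2 (dim_row f) (dim_row v) y + sq_norm2 (dim_col f) (dim_col v) x) / 2"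
      using that[unfolded pairing_contractive_def, rule_format, of "\<lambda>p a. y a p" "\<lambda>q b. x b q"]
      unfolding form[of pair f v y x] sq[of "dim_row f" "dim_row v" y] sq[of "dim_col f" "dim_col v" x] .
  qed
  show ?thesis using half[of pair v f] half[of "\<lambda>f v. pair v f" f v] by blast
qed

section \<open>Polars are closed and rectangular matrix convex\<close>

lemma dim_mat_adjoint [simp]:
  "dim_row (mat_adjoint A) = dim_col A" "dim_col (mat_adjoint A) = dim_row A"
  by (simp_all add: mat_adjoint_def)

lemma index_mat_adjoint:
  "i < dim_col A \<Longrightarrow> j < dim_row A \<Longrightarrow> mat_adjoint A $$ (i, j) = cnj (A $$ (j, i))"
  by (simp add: mat_adjoint_def mat_of_rows_index)

lemma sum_swap_last:
  "(\<Sum>i\<in>A. \<Sum>j\<in>B. \<Sum>c\<in>C. g i j c) = (\<Sum>c\<in>C. \<Sum>i\<in>A. \<Sum>j\<in>B. g i j c)"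
  by (rule trans[OF sum.cong[OF refl sum.swap] sum.swap])

lemma sum_swap_pairs:
  "(\<Sum>i\<in>A. \<Sum>j\<in>B. \<Sum>c\<in>C. \<Sum>d\<in>D. g i j c d) = (\<Sum>c\<in>C. \<Sum>d\<in>D. \<Sum>i\<in>A. \<Sum>j\<in>B. g i j c d)"
  by (rule trans[OF sum_swap_last sum.cong[OF refl sum_swap_last]])

lemma index_gram_sum:
  assumes "\<And>k. k < l \<Longrightarrow> \<alpha> k \<in> carrier_mat (ns k) n" and "i < n" "j < n"
  shows "mat_family_sum n n l (\<lambda>k. mat_adjoint (\<alpha> k) * \<alpha> k) $$ (i, j) =
    (\<Sum>k<l. \<Sum>c<ns k. cnj (\<alpha> k $$ (c, i)) * \<alpha> k $$ (c, j))"
  using assms(2,3) unfolding mat_family_sum_def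
  by (auto simp: scalar_prod_def index_mat_adjoint lessThan_atLeast0 dest!: assms(1) intro!: sum.cong)

lemma mat_form_gram_sum:
  assumes "\<And>k. k < l \<Longrightarrow> \<alpha> k \<in> carrier_mat (ns k) n"
  shows "mat_form (mat_family_sum n n l (\<lambda>k. mat_adjoint (\<alpha> k) * \<alpha> k)) x x =
    (\<Sum>k<l. sq_norm (ns k) (\<lambda>c. \<Sum>p<n. \<alpha> k $$ (c, p) * x p))" (is "mat_form ?A x x = _")
proof -
  have "mat_form ?A x x = (\<Sum>i<n. \<Sum>j<n. cnj (x i) * ?A $$ (i, j) * x j)"
    by (simp add: mat_form_def mat_family_sum_def)
  also have "\<dots> = (\<Sum>i<n. \<Sum>j<n. \<Sum>k<l. \<Sum>c<ns k. cnj (x i) * (cnj (\<alpha> k $$ (c, i)) * \<alpha> k $$ (c, j)) * x j)"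
    by (intro sum.cong refl, subst index_gram_sum[OF assms])
      (simp_all add: sum_distrib_left sum_distrib_right)
  also have "\<dots> = (\<Sum>k<l. \<Sum>i<n. \<Sum>j<n. \<Sum>c<ns k. cnj (x i) * (cnj (\<alpha> k $$ (c, i)) * \<alpha> k $$ (c, j)) * x j)"
    by (rule sum_swap_last)
  also have "\<dots> = (\<Sum>k<l. \<Sum>c<ns k. \<Sum>i<n. \<Sum>j<n. cnj (x i) * (cnj (\<alpha> k $$ (c, i)) * \<alpha> k $$ (c, j)) * x j)"
    by (rule sum.cong[OF refl], rule sum_swap_last)
  also have "\<dots> = (\<Sum>k<l. \<Sum>c<ns k. cnj (\<Sum>p<n. \<alpha> k $$ (c, p) * x p) * (\<Sum>p<n. \<alpha> k $$ (c, p) * x p))"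
    unfolding cnj_sum sum_product by (intro sum.cong refl) (simp add: mult_ac)
  also have "\<dots> = (\<Sum>k<l. sq_norm (ns k) (\<lambda>c. \<Sum>p<n. \<alpha> k $$ (c, p) * x p))"
    unfolding mult.commute[of "cnj _"] complex_norm_square[symmetric] sq_norm_def by simp
  finally show ?thesis .
qed

text \<open>For each fixed \<open>a\<close>, the contribution to the left side is the quadratic form
  of the Gram sum at column \<open>a\<close> of \<open>y\<close>, to which the norm bound
  applies.\<close>

lemma sum_sq_norm2_le:
  assumes "\<And>k. k < l \<Longrightarrow> \<alpha> k \<in> carrier_mat (ns k) n"
  shows "(\<Sum>k<l. sq_norm2 (ns k) r (\<lambda>c a. \<Sum>p<n. \<alpha> k $$ (c, p) * y p a)) \<le>
    mat_op_norm (mat_family_sum n n l (\<lambda>k. mat_adjoint (\<alpha> k) * \<alpha> k)) * sq_norm2 n r y"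
    (is "_ \<le> mat_op_norm ?A * _")
proof -
  have cols: "sq_norm2 n r y = (\<Sum>a<r. sq_norm n (\<lambda>p. y p a))" for n y
    unfolding sq_norm2_def sq_norm_def by (rule sum.swap)
  have dim: "dim_row ?A = n" "dim_col ?A = n" by (simp_all add: mat_family_sum_def)
  have "(\<Sum>k<l. sq_norm2 (ns k) r (\<lambda>c a. \<Sum>p<n. \<alpha> k $$ (c, p) * y p a)) =
      (\<Sum>a<r. \<Sum>k<l. sq_norm (ns k) (\<lambda>c. \<Sum>p<n. \<alpha> k $$ (c, p) * y p a))"
    unfolding cols by (rule sum.swap)
  also have "\<dots> = (\<Sum>a<r. Re (mat_form ?A (\<lambda>p. y p a) (\<lambda>p. y p a)))"
    by (simp add: mat_form_gram_sum[OF assms])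
  also have "\<dots> \<le> (\<Sum>a<r. mat_op_norm ?A * sq_norm n (\<lambda>p. y p a))"
    by (rule sum_mono, rule order_trans[OF Re_mat_form_le]) (simp add: dim)
  also have "\<dots> = mat_op_norm ?A * sq_norm2 n r y" by (simp add: cols sum_distrib_left)
  finally show ?thesis .
qed

section \<open>Polars and matrix convex combinations\<close>

context duality
begin

lemma pair_scale_left: "pair (scaleV c v) w = c * pair v w"
  and pair_sum_left: "pair (\<Sum>i\<in>I. g i) w = (\<Sum>i\<in>I. pair (g i) w)"
proof -
  interpret l: Vector_Spaces.linear scaleV "(*)" "\<lambda>v. pair v w" by (rule linear_left)
  show "pair (scaleV c v) w = c * pair v w"
    "pair (\<Sum>i\<in>I. g i) w = (\<Sum>i\<in>I. pair (g i) w)"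
    by (rule l.scale l.sum)+
qed

lemma pair_scale_right: "pair v (scaleV' c w) = c * pair v w"
  and pair_minus_right: "pair v (- w) = - pair v w"
  and pair_sum_right: "pair v (\<Sum>i\<in>I. h i) = (\<Sum>i\<in>I. pair v (h i))"
proof -
  interpret l: Vector_Spaces.linear scaleV' "(*)" "\<lambda>w. pair v w" by (rule linear_right)
  show "pair v (scaleV' c w) = c * pair v w" "pair v (- w) = - pair v w"
    "pair v (\<Sum>i\<in>I. h i) = (\<Sum>i\<in>I. pair v (h i))"
    by (rule l.scale l.neg l.sum)+
qed

lemma pair_family_sum_compression:
  assumes fam: "\<And>k. k < l \<Longrightarrow> \<alpha> k \<in> carrier_mat (ns k) n \<and> \<beta> k \<in> carrier_mat (ms k) m \<and>
      v k \<in> carrier_mat (ns k) (ms k)"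
    and ij: "i < n" "j < m"
  shows "pair (mat_family_sum n m l (\<lambda>k. mat_compression scaleV (\<alpha> k) (v k) (\<beta> k)) $$ (i, j)) w =
    (\<Sum>k<l. \<Sum>c<ns k. \<Sum>d<ms k. cnj (\<alpha> k $$ (c, i)) * \<beta> k $$ (d, j) * pair (v k $$ (c, d)) w)"
proof -
  have "mat_compression scaleV (\<alpha> k) (v k) (\<beta> k) $$ (i, j) =
      (\<Sum>c<ns k. \<Sum>d<ms k. scaleV (cnj (\<alpha> k $$ (c, i)) * \<beta> k $$ (d, j)) (v k $$ (c, d)))"
    if "k < l" for k
    using fam[OF that] ij by (auto simp: mat_compression_def index_mat_adjoint)
  then show ?thesis
    using ij by (simp add: mat_family_sum_def pair_sum_left pair_scale_left)
qed

text \<open>Compressing \<open>v k\<close> by \<open>\<alpha> k\<close> and \<open>\<beta> k\<close>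
  has the same effect as applying these matrices to the first index of the test arrays; the rest is
  reordering of finite sums.\<close>

lemma pairing_form_family_sum_compression:
  assumes fam: "\<And>k. k < l \<Longrightarrow> \<alpha> k \<in> carrier_mat (ns k) n \<and> \<beta> k \<in> carrier_mat (ms k) m \<and>
      v k \<in> carrier_mat (ns k) (ms k)"
  shows "pairing_form pair (mat_family_sum n m l (\<lambda>k. mat_compression scaleV (\<alpha> k) (v k) (\<beta> k))) f y x =
    (\<Sum>k<l. pairing_form pair (v k) f (\<lambda>c a. \<Sum>p<n. \<alpha> k $$ (c, p) * y p a)
       (\<lambda>d b. \<Sum>q<m. \<beta> k $$ (d, q) * x q b))"
    (is "pairing_form pair ?u f y x = _")
proof -
  \<comment> \<open>With the indices of \<open>f\<close> outermost, only the indices of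
    \<open>v\<close> have to be rearranged in the inner sum.\<close>
  have alt: "pairing_form pair v f y x =
      (\<Sum>a<dim_row f. \<Sum>b<dim_col f. \<Sum>p<n. \<Sum>q<m. cnj (y p a) * pair (v $$ (p, q)) (f $$ (a, b)) * x q b)"
    if "v \<in> carrier_mat n m" for v n m y x
  proof -
    have "pairing_form pair v f y x =
      (\<Sum>a<dim_row f. \<Sum>p<n. \<Sum>q<m. \<Sum>b<dim_col f. cnj (y p a) * pair (v $$ (p, q)) (f $$ (a, b)) * x q b)"
      using that by (auto simp: pairing_form_def intro: sum.swap)
    also have "\<dots> = (\<Sum>a<dim_row f. \<Sum>b<dim_col f. \<Sum>p<n. \<Sum>q<m. cnj (y p a) * pair (v $$ (p, q)) (f $$ (a, b)) * x q b)"
    proof (rule sum.cong[OF refl])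
      fix a
      have "(\<Sum>p<n. \<Sum>q<m. \<Sum>b<dim_col f. cnj (y p a) * pair (v $$ (p, q)) (f $$ (a, b)) * x q b) =
        (\<Sum>p<n. \<Sum>b<dim_col f. \<Sum>q<m. cnj (y p a) * pair (v $$ (p, q)) (f $$ (a, b)) * x q b)"
        by (intro sum.cong refl sum.swap)
      also have "\<dots> = (\<Sum>b<dim_col f. \<Sum>p<n. \<Sum>q<m. cnj (y p a) * pair (v $$ (p, q)) (f $$ (a, b)) * x q b)"
        by (rule sum.swap)
      finally show "(\<Sum>p<n. \<Sum>q<m. \<Sum>b<dim_col f. cnj (y p a) * pair (v $$ (p, q)) (f $$ (a, b)) * x q b) = \<dots>" .
    qed
    finally show ?thesis .
  qed
  have inner: "(\<Sum>p<n. \<Sum>q<m. cnj (y p a) * pair (?u $$ (p, q)) (f $$ (a, b)) * x q b) =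
      (\<Sum>k<l. \<Sum>c<ns k. \<Sum>d<ms k. cnj (\<Sum>p<n. \<alpha> k $$ (c, p) * y p a) * pair (v k $$ (c, d)) (f $$ (a, b)) *
         (\<Sum>q<m. \<beta> k $$ (d, q) * x q b))" for a b
  proof -
    let ?t = "\<lambda>k c d p q. cnj (y p a) * (cnj (\<alpha> k $$ (c, p)) * \<beta> k $$ (d, q) * pair (v k $$ (c, d)) (f $$ (a, b))) * x q b"
    have "(\<Sum>p<n. \<Sum>q<m. cnj (y p a) * pair (?u $$ (p, q)) (f $$ (a, b)) * x q b) =
      (\<Sum>p<n. \<Sum>q<m. \<Sum>k<l. \<Sum>c<ns k. \<Sum>d<ms k. ?t k c d p q)"
      by (intro sum.cong refl, subst pair_family_sum_compression[OF fam])
        (simp_all add: sum_distrib_left sum_distrib_right)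
    also have "\<dots> = (\<Sum>p<n. \<Sum>k<l. \<Sum>q<m. \<Sum>c<ns k. \<Sum>d<ms k. ?t k c d p q)"
      by (rule sum.cong[OF refl], rule sum.swap)
    also have "\<dots> = (\<Sum>k<l. \<Sum>p<n. \<Sum>q<m. \<Sum>c<ns k. \<Sum>d<ms k. ?t k c d p q)"
      by (rule sum.swap)
    also have "\<dots> = (\<Sum>k<l. \<Sum>c<ns k. \<Sum>d<ms k. \<Sum>p<n. \<Sum>q<m. ?t k c d p q)"
      by (rule sum.cong[OF refl], rule sum_swap_pairs)
    also have "\<dots> = (\<Sum>k<l. \<Sum>c<ns k. \<Sum>d<ms k. cnj (\<Sum>p<n. \<alpha> k $$ (c, p) * y p a) * pair (v k $$ (c, d)) (f $$ (a, b)) *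
         (\<Sum>q<m. \<beta> k $$ (d, q) * x q b))"
      by (intro sum.cong refl) (simp add: sum_distrib_left sum_distrib_right mult_ac)
    finally show ?thesis .
  qed
  have "?u \<in> carrier_mat n m" by (simp add: mat_family_sum_def)
  then have "pairing_form pair ?u f y x = (\<Sum>a<dim_row f. \<Sum>b<dim_col f. \<Sum>k<l. \<Sum>c<ns k. \<Sum>d<ms k.
      cnj (\<Sum>p<n. \<alpha> k $$ (c, p) * y p a) * pair (v k $$ (c, d)) (f $$ (a, b)) *
         (\<Sum>q<m. \<beta> k $$ (d, q) * x q b))"
    by (simp only: alt inner)
  also have "\<dots> = (\<Sum>a<dim_row f. \<Sum>k<l. \<Sum>b<dim_col f. \<Sum>c<ns k. \<Sum>d<ms k.
      cnj (\<Sum>p<n. \<alpha> k $$ (c, p) * y p a) * pair (v k $$ (c, d)) (f $$ (a, b)) *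
         (\<Sum>q<m. \<beta> k $$ (d, q) * x q b))"
    by (rule sum.cong[OF refl], rule sum.swap)
  also have "\<dots> = (\<Sum>k<l. \<Sum>a<dim_row f. \<Sum>b<dim_col f. \<Sum>c<ns k. \<Sum>d<ms k.
      cnj (\<Sum>p<n. \<alpha> k $$ (c, p) * y p a) * pair (v k $$ (c, d)) (f $$ (a, b)) *
         (\<Sum>q<m. \<beta> k $$ (d, q) * x q b))"
    by (rule sum.swap)
  also have "\<dots> = (\<Sum>k<l. pairing_form pair (v k) f (\<lambda>c a. \<Sum>p<n. \<alpha> k $$ (c, p) * y p a)
       (\<lambda>d b. \<Sum>q<m. \<beta> k $$ (d, q) * x q b))"
    using fam by (intro sum.cong refl alt[symmetric]) auto
  finally show ?thesis .
qed

text \<open>Multiplying \<open>y\<close> by \<open>sqrt t\<close> and dividing \<open>x\<close> by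
  it leaves the form unchanged. The free parameter \<open>t\<close> serves matrix convexity, which
  controls only a product of two norms.\<close>

lemma pairing_contractive_scaled:
  assumes "pairing_contractive pair v f" "0 < t"
  shows "Re (pairing_form pair v f y x) \<le>
    (t * sq_norm2 (dim_row v) (dim_row f) y + sq_norm2 (dim_col v) (dim_col f) x / t) / 2"
proof -
  define s where "s = complex_of_real (sqrt t)"
  have s: "s \<noteq> 0" "cnj s = s" "cmod s = sqrt t" using assms(2) by (auto simp: s_def)
  have "pairing_form pair v f (\<lambda>p a. s * y p a) (\<lambda>q b. x q b / s) = pairing_form pair v f y x"
    unfolding pairing_form_def using s by (intro sum.cong refl) simp
  moreover have "sq_norm2 r n (\<lambda>p a. s * y p a) = t * sq_norm2 r n y" for r n
    using assms(2) by (simp add: sq_norm2_def norm_mult s power_mult_distrib sum_distrib_left)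
  moreover have "sq_norm2 r n (\<lambda>q b. x q b / s) = sq_norm2 r n x / t" for r n
    using assms(2) by (simp add: sq_norm2_def norm_divide s power_divide sum_divide_distrib)
  ultimately show ?thesis
    using assms(1)[unfolded pairing_contractive_def, rule_format, of "\<lambda>p a. s * y p a" "\<lambda>q b. x q b / s"]
    by simp
qed

lemma polar_eq:
  assumes "0 < n" "0 < m"
  shows "rect_matrix_polar (\<lambda>f v. pair v f) T n m =
    {v \<in> carrier_mat n m. \<forall>r>0. \<forall>s>0. \<forall>f\<in>T r s. pairing_contractive pair v f}"
  unfolding rect_matrix_polar_def pairing_contractive_swap[of pair, symmetric] using assms
  by (auto simp: mat_op_norm_mat_pairing_le_1_iff)

text \<open>The coefficients are shifted to the test arrays, each summand is bounded by the
  contractivity of \<open>v k\<close>, and the bounds recombine through the norms of the two Gram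
  sums.\<close>

lemma rect_matrix_convex_polar: "rect_matrix_convex scaleV (rect_matrix_polar (\<lambda>f v. pair v f) T)"
  unfolding rect_matrix_convex_def
proof (intro conjI allI impI, goal_cases)
  case 1
  then show ?case by (auto simp: mat_collection_def rect_matrix_polar_def)
next
  case (2 n m l ns ms \<alpha> \<beta> v)
  let ?u = "mat_family_sum n m l (\<lambda>k. mat_compression scaleV (\<alpha> k) (v k) (\<beta> k))"
  define A where "A = mat_op_norm (mat_family_sum n n l (\<lambda>k. mat_adjoint (\<alpha> k) * \<alpha> k))"
  define B where "B = mat_op_norm (mat_family_sum m m l (\<lambda>k. mat_adjoint (\<beta> k) * \<beta> k))"
  have AB: "0 \<le> A" "0 \<le> B" "A * B \<le> 1"
    using 2(3) by (auto simp: A_def B_def mat_op_norm_nonneg)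
  \<comment> \<open>Only \<open>A * B \<le> 1\<close> is known; the weight \<open>t = 1 / A\<close>
    balances the two factors. If \<open>A = 0\<close>, any positive \<open>t \<ge> B\<close> will
    do.\<close>
  obtain t where t: "0 < t" "t * A \<le> 1" "B / t \<le> 1"
  proof (cases "A = 0")
    case True
    then show thesis using that[of "B + 1"] AB by simp
  next
    case False
    then show thesis using that[of "1 / A"] AB by (simp add: mult.commute)
  qed
  have fam: "\<alpha> k \<in> carrier_mat (ns k) n \<and> \<beta> k \<in> carrier_mat (ms k) m \<and> v k \<in> carrier_mat (ns k) (ms k)"
    and contr: "\<And>r s f. 0 < r \<Longrightarrow> 0 < s \<Longrightarrow> f \<in> T r s \<Longrightarrow> pairing_contractive pair (v k) f" if "k < l" for k
    using 2(3) that by (auto simp: polar_eq)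
  have "pairing_contractive pair ?u f" if f: "0 < r" "0 < s" "f \<in> T r s" for r s f
    unfolding pairing_contractive_def
  proof (intro allI)
    fix y x :: "nat \<Rightarrow> nat \<Rightarrow> complex"
    let ?y = "\<lambda>k c a. \<Sum>p<n. \<alpha> k $$ (c, p) * y p a" and ?x = "\<lambda>k d b. \<Sum>q<m. \<beta> k $$ (d, q) * x q b"
    have "Re (pairing_form pair ?u f y x) = (\<Sum>k<l. Re (pairing_form pair (v k) f (?y k) (?x k)))"
      by (subst pairing_form_family_sum_compression[OF fam]) simp_all
    also have "\<dots> \<le> (\<Sum>k<l. (t * sq_norm2 (ns k) (dim_row f) (?y k) + sq_norm2 (ms k) (dim_col f) (?x k) / t) / 2)"
    proof (rule sum_mono)
      fix k assume "k \<in> {..<l}"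
      then show "Re (pairing_form pair (v k) f (?y k) (?x k)) \<le>
          (t * sq_norm2 (ns k) (dim_row f) (?y k) + sq_norm2 (ms k) (dim_col f) (?x k) / t) / 2"
        using pairing_contractive_scaled[OF contr[OF _ f] t(1), of k "?y k" "?x k"] fam[of k] by auto
    qed
    also have "\<dots> = (t * (\<Sum>k<l. sq_norm2 (ns k) (dim_row f) (?y k)) +
        (\<Sum>k<l. sq_norm2 (ms k) (dim_col f) (?x k)) / t) / 2"
      by (simp add: sum_divide_distrib sum.distrib sum_distrib_left add_divide_distrib)
    also have "\<dots> \<le> (t * (A * sq_norm2 n (dim_row f) y) + (B * sq_norm2 m (dim_col f) x) / t) / 2"
      unfolding A_def B_def using t(1) fam
      by (intro divide_right_mono add_mono mult_left_mono sum_sq_norm2_le) auto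
    also have "\<dots> = ((t * A) * sq_norm2 n (dim_row f) y + (B / t) * sq_norm2 m (dim_col f) x) / 2"
      by simp
    also have "\<dots> \<le> (1 * sq_norm2 n (dim_row f) y + 1 * sq_norm2 m (dim_col f) x) / 2"
      using t by (intro divide_right_mono add_mono mult_right_mono) (auto simp: sq_norm2_def sum_nonneg)
    finally show "Re (pairing_form pair ?u f y x) \<le>
        (sq_norm2 (dim_row ?u) (dim_row f) y + sq_norm2 (dim_col ?u) (dim_col f) x) / 2"
      by (simp add: mat_family_sum_def)
  qed
  moreover have "?u \<in> carrier_mat n m" by (simp add: mat_family_sum_def)
  ultimately show ?case using 2(1,2) by (simp add: polar_eq)
qed

end

section \<open>Weak topologies on spaces of matrices\<close>

lemma topspace_weak_topology [simp]: "topspace (weak_topology pair) = UNIV"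
  unfolding weak_topology_def topology_generated_by_topspace by auto

lemma topspace_weak_mat_topology [simp]: "topspace (weak_mat_topology pair n m) = carrier_mat n m"
  unfolding weak_mat_topology_def topspace_pullback_topology by auto

lemma continuous_map_weak_topology: "continuous_map (weak_topology pair) euclidean (\<lambda>v. pair v w)"
  unfolding continuous_map_def
proof (intro conjI allI impI)
  fix U :: "complex set" assume "openin euclidean U"
  then have "{v. pair v w \<in> U} \<in> {{v. pair v w \<in> U} | w U. open U}" by auto
  then show "openin (weak_topology pair) {v \<in> topspace (weak_topology pair). pair v w \<in> U}"
    unfolding topspace_weak_topology unfolding weak_topology_def by (simp add: topology_generated_by_Basis)
qed simp

lemma continuous_map_weak_mat_topology:
  assumes "i < n" "j < m"
  shows "continuous_map (weak_mat_topology pair n m) euclidean (\<lambda>v. pair (v $$ (i, j)) w)"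
proof -
  let ?I = "{..<n} \<times> {..<m}"
  have "continuous_map (product_topology (\<lambda>_. weak_topology pair) ?I) euclidean ((\<lambda>v. pair v w) \<circ> (\<lambda>g. g (i, j)))"
    using assms by (intro continuous_map_compose[OF _ continuous_map_weak_topology]
      continuous_map_product_projection) auto
  then have "continuous_map (weak_mat_topology pair n m) euclidean
      (((\<lambda>v. pair v w) \<circ> (\<lambda>g. g (i, j))) \<circ> (\<lambda>A. \<lambda>ij\<in>?I. A $$ ij))"
    unfolding weak_mat_topology_def by (rule continuous_map_pullback)
  then show ?thesis using assms by (simp add: o_def)
qed

text \<open>Induction on the generation of the topology; an intersection takes the union of the two
  finite sets and the smaller radius. Finiteness of \<open>W\<close> is what makes the later
  separation finite-dimensional.\<close>

lemma openin_weak_topology_imp_nbhd: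
  assumes "openin (weak_topology pair) U" "x \<in> U"
  obtains W \<epsilon> where "finite W" "0 < \<epsilon>" "\<And>v. (\<And>w. w \<in> W \<Longrightarrow> cmod (pair v w - pair x w) < \<epsilon>) \<Longrightarrow> v \<in> U"
proof -
  have "generate_topology_on {{v. pair v w \<in> U} | w U. open U} U"
    using assms(1) by (simp add: weak_topology_def openin_topology_generated_by_iff)
  then have "x \<in> U \<longrightarrow> (\<exists>W \<epsilon>. finite W \<and> 0 < \<epsilon> \<and> (\<forall>v. (\<forall>w\<in>W. cmod (pair v w - pair x w) < \<epsilon>) \<longrightarrow> v \<in> U))"
  proof induction
    case (Int A B)
    show ?case
    proof
      assume "x \<in> A \<inter> B"
      then obtain W \<epsilon> W' \<epsilon>' where "finite W" "0 < \<epsilon>" "\<forall>v. (\<forall>w\<in>W. cmod (pair v w - pair x w) < \<epsilon>) \<longrightarrow> v \<in> A"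
        "finite W'" "0 < \<epsilon>'" "\<forall>v. (\<forall>w\<in>W'. cmod (pair v w - pair x w) < \<epsilon>') \<longrightarrow> v \<in> B"
        using Int by auto
      then show "\<exists>W \<epsilon>. finite W \<and> 0 < \<epsilon> \<and> (\<forall>v. (\<forall>w\<in>W. cmod (pair v w - pair x w) < \<epsilon>) \<longrightarrow> v \<in> A \<inter> B)"
        by (intro exI[of _ "W \<union> W'"] exI[of _ "min \<epsilon> \<epsilon>'"]) auto
    qed
  next
    case (UN K)
    show ?case
    proof
      assume "x \<in> \<Union>K"
      then obtain k where k: "k \<in> K" "x \<in> k" by blast
      with UN.IH[OF k(1)] obtain W \<epsilon> where "finite W" "0 < \<epsilon>"
        "\<forall>v. (\<forall>w\<in>W. cmod (pair v w - pair x w) < \<epsilon>) \<longrightarrow> v \<in> k" by blast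
      with k show "\<exists>W \<epsilon>. finite W \<and> 0 < \<epsilon> \<and> (\<forall>v. (\<forall>w\<in>W. cmod (pair v w - pair x w) < \<epsilon>) \<longrightarrow> v \<in> \<Union>K)"
        by blast
    qed
  next
    case (Basis s)
    then obtain w U where s: "s = {v. pair v w \<in> U}" "open U" by auto
    show ?case
    proof
      assume "x \<in> s"
      then obtain \<epsilon> where "0 < \<epsilon>" "\<forall>z. dist z (pair x w) < \<epsilon> \<longrightarrow> z \<in> U"
        using s by (metis mem_Collect_eq open_dist)
      then show "\<exists>W \<epsilon>. finite W \<and> 0 < \<epsilon> \<and> (\<forall>v. (\<forall>w\<in>W. cmod (pair v w - pair x w) < \<epsilon>) \<longrightarrow> v \<in> s)"
        by (intro exI[of _ "{w}"] exI[of _ \<epsilon>]) (simp add: s dist_norm)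
    qed
  qed simp
  then show thesis using that assms(2) by blast
qed

text \<open>A basic open box gives a finite set and a radius for each entry. There are finitely many
  entries, so these merge into one finite set and one radius.\<close>

lemma openin_weak_mat_topology_imp_nbhd:
  assumes "openin (weak_mat_topology pair n m) U" "x \<in> U"
  obtains W \<epsilon> where "finite W" "0 < \<epsilon>"
    "\<And>v. v \<in> carrier_mat n m \<Longrightarrow>
       (\<And>i j w. i < n \<Longrightarrow> j < m \<Longrightarrow> w \<in> W \<Longrightarrow> cmod (pair (v $$ (i, j)) w - pair (x $$ (i, j)) w) < \<epsilon>) \<Longrightarrow> v \<in> U"
proof -
  define I where "I = {..<n} \<times> {..<m}"
  define e where "e A = (\<lambda>ij\<in>I. A $$ ij)" for A :: "'a mat"
  obtain O' where O': "openin (product_topology (\<lambda>_. weak_topology pair) I) O'" "U = e -` O' \<inter> carrier_mat n m"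
    using assms(1) unfolding weak_mat_topology_def openin_pullback_topology I_def e_def by auto
  have "e x \<in> O'" using assms(2) O'(2) by auto
  then obtain B where B: "\<And>i. i \<in> I \<Longrightarrow> openin (weak_topology pair) (B i)" "e x \<in> Pi\<^sub>E I B" "Pi\<^sub>E I B \<subseteq> O'"
    using O'(1) unfolding openin_product_topology_alt by meson
  have "\<exists>W \<epsilon>. finite W \<and> 0 < \<epsilon> \<and> (\<forall>v. (\<forall>w\<in>W. cmod (pair v w - pair (x $$ i) w) < \<epsilon>) \<longrightarrow> v \<in> B i)" if "i \<in> I" for i
  proof -
    have "x $$ i \<in> B i" using B(2) that by (auto simp: e_def PiE_iff)
    then show ?thesis using openin_weak_topology_imp_nbhd[OF B(1)[OF that]] by metis
  qed
  then obtain W \<epsilon> where W: "\<And>i. i \<in> I \<Longrightarrow> finite (W i)" "\<And>i. i \<in> I \<Longrightarrow> 0 < \<epsilon> i"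
    "\<And>i v. i \<in> I \<Longrightarrow> (\<forall>w\<in>W i. cmod (pair v w - pair (x $$ i) w) < \<epsilon> i) \<Longrightarrow> v \<in> B i"
    by metis
  \<comment> \<open>The element \<open>1\<close> keeps the set nonempty when there are no
    entries.\<close>
  define \<delta> where "\<delta> = Min (insert 1 (\<epsilon> ` I))"
  have fin: "finite I" by (simp add: I_def)
  show thesis
  proof
    show "finite (\<Union>i\<in>I. W i)" using fin W(1) by auto
    show "0 < \<delta>" using fin W(2) by (simp add: \<delta>_def)
    fix v assume v: "v \<in> carrier_mat n m" and
      near: "\<And>i j w. i < n \<Longrightarrow> j < m \<Longrightarrow> w \<in> (\<Union>i\<in>I. W i) \<Longrightarrow> cmod (pair (v $$ (i, j)) w - pair (x $$ (i, j)) w) < \<delta>"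
    have "v $$ i \<in> B i" if "i \<in> I" for i
    proof (rule W(3)[OF that], rule ballI)
      fix w assume "w \<in> W i"
      then have "cmod (pair (v $$ i) w - pair (x $$ i) w) < \<delta>"
        using near[OF _ _ UN_I[OF that], of "fst i" "snd i"] that by (auto simp: I_def)
      also have "\<delta> \<le> \<epsilon> i" using fin that by (simp add: \<delta>_def)
      finally show "cmod (pair (v $$ i) w - pair (x $$ i) w) < \<epsilon> i" .
    qed
    then have "e v \<in> Pi\<^sub>E I B" by (auto simp: e_def)
    then show "v \<in> U" using B(3) O'(2) v by auto
  qed
qed

lemma closedin_Collect_le:
  assumes "\<And>z. z \<in> Z \<Longrightarrow> continuous_map X euclideanreal (h z)"
  shows "closedin X {v \<in> topspace X. \<forall>z\<in>Z. h z v \<le> c z}"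
proof -
  have "closedin X {v \<in> topspace X. h z v \<in> {..c z}}" if "z \<in> Z" for z
    using assms[OF that] by (intro closedin_continuous_map_preimage) auto
  then have "closedin X (\<Inter> (insert (topspace X) ((\<lambda>z. {v \<in> topspace X. h z v \<le> c z}) ` Z)))"
    by (intro closedin_Inter) auto
  also have "\<Inter> (insert (topspace X) ((\<lambda>z. {v \<in> topspace X. h z v \<le> c z}) ` Z)) =
      {v \<in> topspace X. \<forall>z\<in>Z. h z v \<le> c z}" by auto
  finally show ?thesis .
qed

text \<open>For fixed \<open>f\<close>, \<open>y\<close> and \<open>x\<close>, contractivity bounds
  a weakly continuous function of \<open>v\<close> by a constant, so the polar is an intersection of
  closed sets.\<close>

lemma (in duality) closedin_polar:
  assumes "0 < n" "0 < m"
  shows "closedin (weak_mat_topology pair n m) (rect_matrix_polar (\<lambda>f v. pair v f) T n m)"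
proof -
  let ?X = "weak_mat_topology pair n m"
  define Z where "Z = (\<Union>r\<in>{0<..}. \<Union>s\<in>{0<..}. T r s) \<times>
    (UNIV :: (nat \<Rightarrow> nat \<Rightarrow> complex) set) \<times> (UNIV :: (nat \<Rightarrow> nat \<Rightarrow> complex) set)"
  define h where "h = (\<lambda>(f, y, x) v. \<Sum>p<n. \<Sum>a<dim_row f. \<Sum>q<m. \<Sum>b<dim_col f.
    Re (cnj (y p a) * pair (v $$ (p, q)) (f $$ (a, b)) * x q b))"
  define c where "c = (\<lambda>(f :: 'w mat, y, x). (sq_norm2 n (dim_row f) y + sq_norm2 m (dim_col f) x) / 2)"
  have cont: "continuous_map euclidean euclideanreal (\<lambda>z. Re (a * z * b))" for a b
    unfolding continuous_map_iff_continuous2 by (intro continuous_intros)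
  have "continuous_map ?X euclideanreal (\<lambda>v. Re (a * pair (v $$ (p, q)) w * b))"
    if "p < n" "q < m" for p q w a b
    using continuous_map_compose[OF continuous_map_weak_mat_topology[OF that, of pair w] cont[of a b]]
    unfolding o_def .
  then have "continuous_map ?X euclideanreal (h z)" for z
    by (cases z) (auto simp only: h_def prod.case lessThan_iff intro!: continuous_map_sum finite_lessThan)
  then have "closedin ?X {v \<in> topspace ?X. \<forall>z\<in>Z. h z v \<le> c z}"
    by (intro closedin_Collect_le)
  also have "{v \<in> topspace ?X. \<forall>z\<in>Z. h z v \<le> c z} = rect_matrix_polar (\<lambda>f v. pair v f) T n m"
    unfolding polar_eq[OF assms] topspace_weak_mat_topology
  proof (intro Collect_cong conj_cong refl)
    fix v :: "'v mat" assume v: "v \<in> carrier_mat n m"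
    have "h (f, y, x) v \<le> c (f, y, x) \<longleftrightarrow>
        Re (pairing_form pair v f y x) \<le> (sq_norm2 (dim_row v) (dim_row f) y + sq_norm2 (dim_col v) (dim_col f) x) / 2"
      for f y x
      using v by (simp only: h_def c_def pairing_form_def prod.case Re_sum carrier_matD)
    then have "(\<forall>z\<in>Z. h z v \<le> c z) \<longleftrightarrow> (\<forall>f\<in>(\<Union>r\<in>{0<..}. \<Union>s\<in>{0<..}. T r s). pairing_contractive pair v f)"
      unfolding Z_def pairing_contractive_def by blast
    then show "(\<forall>z\<in>Z. h z v \<le> c z) \<longleftrightarrow> (\<forall>r>0. \<forall>s>0. \<forall>f\<in>T r s. pairing_contractive pair v f)"
      by auto
  qed
  finally show ?thesis .
qed

section \<open>Factorization of positive forms\<close>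

text \<open>Cholesky factorization, by splitting off the last variable and passing to the Schur complement.\<close>

lemma positive_form_sum_squares:
  fixes h :: "nat \<Rightarrow> nat \<Rightarrow> complex"
  assumes "\<And>i j. h j i = cnj (h i j)"
    and "\<And>x i. i < n \<Longrightarrow> x i \<noteq> 0 \<Longrightarrow> 0 < Re (\<Sum>i<n. \<Sum>j<n. h i j * cnj (x i) * x j)"
  shows "\<exists>R. \<forall>x. (\<Sum>i<n. \<Sum>j<n. h i j * cnj (x i) * x j) = sq_norm n (\<lambda>i. \<Sum>j<n. R i j * x j)"
  using assms
proof (induction n arbitrary: h)
    case 0
    show ?case by (simp add: sq_norm_def)
  next
    case (Suc n)
    define d where "d = Re (h n n)"
    \<comment> \<open>At the last unit vector the form takes the value of the pivot, whose real part
      \<open>d\<close> is therefore positive.\<close>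
    have "(\<Sum>j<Suc n. h i j * cnj (of_bool (i = n)) * of_bool (j = n)) = (if i = n then h n n else 0)" for i
      by (auto intro!: sum.neutral)
    then have "Re (\<Sum>i<Suc n. \<Sum>j<Suc n. h i j * cnj (of_bool (i = n)) * of_bool (j = n)) = d"
      by (simp only: d_def sum.delta finite_lessThan) simp
    then have d: "0 < d" using Suc.prems(2)[of n "\<lambda>i. of_bool (i = n)"] by simp
    have "Im (h n n) = Im (cnj (h n n))" by (rule arg_cong[OF Suc.prems(1)])
    then have hnn: "h n n = d" by (simp add: d_def complex_eq_iff)
    define S where "S x = (\<Sum>j<n. h n j * x j)" for x
    have cnj_S: "cnj (S x) = (\<Sum>i<n. h i n * cnj (x i))" for x
      unfolding S_def cnj_sum by (intro sum.cong refl) (simp add: Suc.prems(1)[of n])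
    define h' where "h' i j = h i j - h i n * h n j / d" for i j
    have schur: "(\<Sum>i<n. \<Sum>j<n. h' i j * cnj (x i) * x j) =
        (\<Sum>i<n. \<Sum>j<n. h i j * cnj (x i) * x j) - cnj (S x) * S x / d" for x
    proof -
      have "cnj (S x) * S x / d = (\<Sum>i<n. \<Sum>j<n. h i n * h n j / d * cnj (x i) * x j)"
        unfolding cnj_S unfolding S_def sum_product sum_divide_distrib by (intro sum.cong refl) simp
      then show ?thesis by (simp add: h'_def left_diff_distrib sum_subtractf)
    qed
    have split: "(\<Sum>i<Suc n. \<Sum>j<Suc n. h i j * cnj (x i) * x j) =
        (\<Sum>i<n. \<Sum>j<n. h' i j * cnj (x i) * x j) + d * (cnj (x n + S x / d) * (x n + S x / d))" for x
    proof -
      have "(\<Sum>i<Suc n. \<Sum>j<Suc n. h i j * cnj (x i) * x j) =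
        (\<Sum>i<n. \<Sum>j<n. h i j * cnj (x i) * x j) + cnj (S x) * x n + cnj (x n) * S x + d * cnj (x n) * x n"
        unfolding cnj_S by (simp add: S_def hnn sum.distrib sum_distrib_left sum_distrib_right mult_ac)
      moreover have "d * (cnj (x n + S x / d) * (x n + S x / d)) =
          cnj (S x) * S x / d + cnj (S x) * x n + cnj (x n) * S x + d * cnj (x n) * x n"
        using d by (simp add: field_simps)
      ultimately show ?thesis unfolding schur by (simp only: algebra_simps)
    qed
    have herm: "h' j i = cnj (h' i j)" for i j
      unfolding h'_def using Suc.prems(1)[of j i] Suc.prems(1)[of j n] Suc.prems(1)[of n i] by simp
    have pos: "0 < Re (\<Sum>i<n. \<Sum>j<n. h' i j * cnj (x i) * x j)" if "i < n" "x i \<noteq> 0" for x i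
    proof -
      \<comment> \<open>The last coordinate is chosen to make the completed square vanish, so
        positivity of the full form at \<open>x'\<close> is positivity of the Schur complement at
        \<open>x\<close>.\<close>
      define x' where "x' = x(n := - S x / d)"
      have "S x' = S x" by (simp add: S_def x'_def)
      then have "x' n + S x' / d = 0" by (simp add: x'_def)
      then have "(\<Sum>i<Suc n. \<Sum>j<Suc n. h i j * cnj (x' i) * x' j) = (\<Sum>i<n. \<Sum>j<n. h' i j * cnj (x' i) * x' j)"
        unfolding split by simp
      also have "\<dots> = (\<Sum>i<n. \<Sum>j<n. h' i j * cnj (x i) * x j)"
        by (intro sum.cong refl) (simp add: x'_def)
      finally show ?thesis using Suc.prems(2)[of i x'] that by (simp add: x'_def)
    qed
    obtain R where R: "\<And>x. (\<Sum>i<n. \<Sum>j<n. h' i j * cnj (x i) * x j) = sq_norm n (\<lambda>i. \<Sum>j<n. R i j * x j)"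
    proof -
      have "\<exists>R. \<forall>x. (\<Sum>i<n. \<Sum>j<n. h' i j * cnj (x i) * x j) = sq_norm n (\<lambda>i. \<Sum>j<n. R i j * x j)"
        by (rule Suc.IH, rule herm, rule pos)
      then show ?thesis using that by blast
    qed
    \<comment> \<open>The new last row represents \<open>sqrt d * (x n + S x / d)\<close>, whose
      squared modulus is the completed square.\<close>
    define R' where "R' i j = (if i < n then (if j < n then R i j else 0)
        else if j < n then sqrt d * (h n j / d) else sqrt d)" for i j
    have "sq_norm (Suc n) (\<lambda>i. \<Sum>j<Suc n. R' i j * x j) =
        sq_norm n (\<lambda>i. \<Sum>j<n. R i j * x j) + d * (cmod (x n + S x / d))\<^sup>2" for x
    proof -
      have "(\<Sum>j<Suc n. R' n j * x j) = sqrt d * (x n + S x / d)"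
        by (simp add: R'_def S_def distrib_left sum_distrib_left sum_divide_distrib mult_ac)
      then have "(cmod (\<Sum>j<Suc n. R' n j * x j))\<^sup>2 = d * (cmod (x n + S x / d))\<^sup>2"
        using d by (simp add: norm_mult power_mult_distrib)
      moreover have "(\<Sum>j<Suc n. R' i j * x j) = (\<Sum>j<n. R i j * x j)" if "i < n" for i
        using that by (simp add: R'_def)
      ultimately show ?thesis unfolding sq_norm_def sum.lessThan_Suc[of _ n] by simp
    qed
    then have "(\<Sum>i<Suc n. \<Sum>j<Suc n. h i j * cnj (x i) * x j) = sq_norm (Suc n) (\<lambda>i. \<Sum>j<Suc n. R' i j * x j)" for x
      unfolding split R mult.commute[of "cnj _"] complex_norm_square[symmetric] by simp
    then show ?case by blast
qed

text \<open>An injective square matrix has nonzero determinant. Both one-sided identities are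
  recorded: later \<open>R G = 1\<close> simplifies norms, while \<open>G R = 1\<close> recovers the
  separated matrix.\<close>

lemma inverse_of_injective:
  fixes R :: "nat \<Rightarrow> nat \<Rightarrow> 'a::field"
  assumes inj: "\<And>x i. (\<And>k. k < n \<Longrightarrow> (\<Sum>j<n. R k j * x j) = 0) \<Longrightarrow> i < n \<Longrightarrow> x i = 0"
  obtains G where "\<And>i k. i < n \<Longrightarrow> k < n \<Longrightarrow> (\<Sum>j<n. R i j * G j k) = of_bool (i = k)"
    "\<And>i k. i < n \<Longrightarrow> k < n \<Longrightarrow> (\<Sum>j<n. G i j * R j k) = of_bool (i = k)"
proof -
  define M where "M = mat n n (\<lambda>(i, j). R i j)"
  have M: "M \<in> carrier_mat n n" by (simp add: M_def)
  have "det M \<noteq> 0"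
  proof
    assume "det M = 0"
    then obtain v where v: "v \<in> carrier_vec n" "v \<noteq> 0\<^sub>v n" "M *\<^sub>v v = 0\<^sub>v n"
      using det_0_iff_vec_prod_zero_field[OF M] by auto
    have "(\<Sum>j<n. R k j * v $ j) = 0" if "k < n" for k
    proof -
      have "(M *\<^sub>v v) $ k = 0" using v(3) that by simp
      then show ?thesis using v(1) that by (simp add: M_def scalar_prod_def lessThan_atLeast0)
    qed
    then have "v $ i = 0" if "i < n" for i using inj[of "($) v" i] that by blast
    then show False using v by auto
  qed
  then obtain B where B: "B \<in> carrier_mat n n" "B * M = 1\<^sub>m n" "M * B = 1\<^sub>m n"
    using det_non_zero_imp_unit[OF M, of "()"] by (auto simp: Units_def ring_mat_def)
  show thesis
  proof
    fix i k assume ik: "i < n" "k < n"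
    then have "(M * B) $$ (i, k) = of_bool (i = k)" "(B * M) $$ (i, k) = of_bool (i = k)"
      using B by auto
    then show "(\<Sum>j<n. R i j * B $$ (j, k)) = of_bool (i = k)" "(\<Sum>j<n. B $$ (i, j) * R j k) = of_bool (i = k)"
      using ik B(1) by (auto simp: M_def scalar_prod_def lessThan_atLeast0)
  qed
qed

text \<open>Only the real part of the form matters, so \<open>a\<close> is replaced by its Hermitian
  part. Adding \<open>\<delta>\<close> times the identity makes it strictly positive, hence a sum of
  squares with an injective, thus invertible, \<open>R\<close>.\<close>

lemma nonneg_form_factorization:
  fixes a :: "nat \<Rightarrow> nat \<Rightarrow> complex"
  assumes nonneg: "\<And>x. 0 \<le> Re (\<Sum>i<n. \<Sum>j<n. a i j * cnj (x i) * x j)" and \<delta>: "0 < \<delta>"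
  obtains R G where
    "\<And>x. Re (\<Sum>i<n. \<Sum>j<n. a i j * cnj (x i) * x j) + \<delta> * sq_norm n x = sq_norm n (\<lambda>i. \<Sum>j<n. R i j * x j)"
    "\<And>i k. i < n \<Longrightarrow> k < n \<Longrightarrow> (\<Sum>j<n. R i j * G j k) = of_bool (i = k)"
    "\<And>i k. i < n \<Longrightarrow> k < n \<Longrightarrow> (\<Sum>j<n. G i j * R j k) = of_bool (i = k)"
proof -
  define h where "h i j = (a i j + cnj (a j i)) / 2 + \<delta> * of_bool (i = j)" for i j
  have herm: "h j i = cnj (h i j)" for i j by (simp add: h_def add.commute eq_commute)
  have h: "Re (\<Sum>i<n. \<Sum>j<n. h i j * cnj (x i) * x j) =
      Re (\<Sum>i<n. \<Sum>j<n. a i j * cnj (x i) * x j) + \<delta> * sq_norm n x" for x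
  proof -
    define s where "s = (\<Sum>i<n. \<Sum>j<n. a i j * cnj (x i) * x j)"
    have "(\<Sum>i<n. \<Sum>j<n. cnj (a j i) * cnj (x i) * x j) = cnj s"
      unfolding s_def cnj_sum by (rule trans[OF sum.swap]) (intro sum.cong refl, simp)
    moreover have "(\<Sum>i<n. \<Sum>j<n. complex_of_real \<delta> * of_bool (i = j) * cnj (x i) * x j) = \<delta> * sq_norm n x"
    proof -
      have "(\<Sum>i<n. \<Sum>j<n. complex_of_real \<delta> * of_bool (i = j) * cnj (x i) * x j) = (\<Sum>i<n. \<delta> * (x i * cnj (x i)))"
        by (intro sum.cong refl) (simp add: of_bool_def if_distrib[of "\<lambda>z. _ * z"] if_distribR mult_ac cong: if_cong)
      then show ?thesis
        unfolding complex_norm_square[symmetric] by (simp add: sq_norm_def sum_distrib_left)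
    qed
    moreover have "(\<Sum>i<n. \<Sum>j<n. h i j * cnj (x i) * x j) =
        ((\<Sum>i<n. \<Sum>j<n. a i j * cnj (x i) * x j) + (\<Sum>i<n. \<Sum>j<n. cnj (a j i) * cnj (x i) * x j)) / 2 +
        (\<Sum>i<n. \<Sum>j<n. complex_of_real \<delta> * of_bool (i = j) * cnj (x i) * x j)"
      unfolding sum.distrib[symmetric] sum_divide_distrib h_def
      by (intro sum.cong refl) (simp add: field_simps)
    ultimately have "(\<Sum>i<n. \<Sum>j<n. h i j * cnj (x i) * x j) = (s + cnj s) / 2 + \<delta> * sq_norm n x"
      unfolding s_def by (simp only:)
    then show ?thesis unfolding s_def[symmetric] by simp
  qed
  have pos: "0 < sq_norm n x" if "i < n" "x i \<noteq> 0" for x i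
    unfolding sq_norm_def using that by (intro sum_pos2[of _ i]) auto
  have h_pos: "0 < Re (\<Sum>i<n. \<Sum>j<n. h i j * cnj (x i) * x j)" if "i < n" "x i \<noteq> 0" for x i
    unfolding h using nonneg \<delta> pos[of i x] that by (intro add_nonneg_pos mult_pos_pos) auto
  have "\<exists>R. \<forall>x. (\<Sum>i<n. \<Sum>j<n. h i j * cnj (x i) * x j) = sq_norm n (\<lambda>i. \<Sum>j<n. R i j * x j)"
    by (rule positive_form_sum_squares, rule herm, rule h_pos)
  then obtain R where
    R: "\<And>x. (\<Sum>i<n. \<Sum>j<n. h i j * cnj (x i) * x j) = sq_norm n (\<lambda>i. \<Sum>j<n. R i j * x j)"
    by blast
  then have R_eq: "Re (\<Sum>i<n. \<Sum>j<n. a i j * cnj (x i) * x j) + \<delta> * sq_norm n x = sq_norm n (\<lambda>i. \<Sum>j<n. R i j * x j)" for x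
    unfolding h[symmetric] by simp
  have "x i = 0" if "\<And>k. k < n \<Longrightarrow> (\<Sum>j<n. R k j * x j) = 0" "i < n" for x i
  proof (rule ccontr)
    assume "x i \<noteq> 0"
    then have "0 < \<delta> * sq_norm n x" using pos \<delta> that(2) by simp
    moreover have "sq_norm n (\<lambda>i. \<Sum>j<n. R i j * x j) = 0" using that(1) by (simp add: sq_norm_def)
    ultimately show False using R_eq[of x] nonneg[of x] by linarith
  qed
  then obtain G where "\<And>i k. i < n \<Longrightarrow> k < n \<Longrightarrow> (\<Sum>j<n. R i j * G j k) = of_bool (i = k)"
    "\<And>i k. i < n \<Longrightarrow> k < n \<Longrightarrow> (\<Sum>j<n. G i j * R j k) = of_bool (i = k)"
    using inverse_of_injective[of n R] by blast
  with R_eq show thesis by (rule that)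
qed

section \<open>Separation from closed rectangular matrix convex sets\<close>

text \<open>The deviation from the identity has operator norm at most the sum of the moduli of its
  entries, so division by \<open>1 + e\<close> leaves a contraction. This normalizes Gram sums that
  are merely close to the identity.\<close>

lemma mat_op_norm_near_identity_le_1:
  fixes A :: "nat \<Rightarrow> nat \<Rightarrow> complex"
  assumes near: "(\<Sum>i<n. \<Sum>j<n. cmod (A i j - of_bool (i = j))) \<le> e" and "0 \<le> e"
  shows "mat_op_norm (mat n n (\<lambda>(i, j). A i j / of_real (1 + e))) \<le> 1"
  unfolding mat_op_norm_le_1_iff
proof (intro allI)
  fix y x :: "nat \<Rightarrow> complex"
  define s where "s = (sq_norm n y + sq_norm n x) / 2"
  have s: "0 \<le> s" by (simp add: s_def sq_norm_nonneg)
  have bound: "cmod (y i) * cmod (x j) \<le> ((cmod (y i))\<^sup>2 + (cmod (x j))\<^sup>2) / 2" for i j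
    using sum_squares_bound[of "cmod (y i)" "cmod (x j)"] by simp
  have entry: "cmod (y i) * cmod (x j) \<le> s" if "i < n" "j < n" for i j
  proof -
    have "(cmod (y i))\<^sup>2 \<le> sq_norm n y" "(cmod (x j))\<^sup>2 \<le> sq_norm n x"
      unfolding sq_norm_def using that by (auto intro!: member_le_sum)
    then show ?thesis using bound[of i j] by (simp add: s_def)
  qed
  have "Re (cnj (y i) * A i j * x j) \<le> of_bool (i = j) * (((cmod (y i))\<^sup>2 + (cmod (x j))\<^sup>2) / 2) +
      cmod (A i j - of_bool (i = j)) * s" if "i < n" "j < n" for i j
  proof -
    have "Re (cnj (y i) * A i j * x j) =
        Re (of_bool (i = j) * (cnj (y i) * x j)) + Re ((A i j - of_bool (i = j)) * (cnj (y i) * x j))"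
      by (simp only: plus_complex.simps[symmetric]) (simp add: algebra_simps)
    also have "\<dots> \<le> cmod (of_bool (i = j) * (cnj (y i) * x j)) + cmod ((A i j - of_bool (i = j)) * (cnj (y i) * x j))"
      by (intro add_mono complex_Re_le_cmod)
    also have "\<dots> = of_bool (i = j) * (cmod (y i) * cmod (x j)) + cmod (A i j - of_bool (i = j)) * (cmod (y i) * cmod (x j))"
      by (cases "i = j") (simp_all add: norm_mult)
    also have "\<dots> \<le> of_bool (i = j) * (((cmod (y i))\<^sup>2 + (cmod (x j))\<^sup>2) / 2) + cmod (A i j - of_bool (i = j)) * s"
      using bound entry[OF that] by (intro add_mono mult_left_mono) auto
    finally show ?thesis .
  qed
  then have "(\<Sum>i<n. \<Sum>j<n. Re (cnj (y i) * A i j * x j)) \<le>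
      (\<Sum>i<n. \<Sum>j<n. of_bool (i = j) * (((cmod (y i))\<^sup>2 + (cmod (x j))\<^sup>2) / 2) + cmod (A i j - of_bool (i = j)) * s)"
    by (intro sum_mono) auto
  also have "\<dots> = (\<Sum>i<n. \<Sum>j<n. of_bool (i = j) * (((cmod (y i))\<^sup>2 + (cmod (x j))\<^sup>2) / 2)) +
      (\<Sum>i<n. \<Sum>j<n. cmod (A i j - of_bool (i = j))) * s"
    by (simp add: sum.distrib sum_distrib_right)
  also have "(\<Sum>i<n. \<Sum>j<n. of_bool (i = j) * (((cmod (y i))\<^sup>2 + (cmod (x j))\<^sup>2) / 2)) = s"
  proof -
    have "(\<Sum>i<n. \<Sum>j<n. of_bool (i = j) * (((cmod (y i))\<^sup>2 + (cmod (x j))\<^sup>2) / 2)) =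
        (\<Sum>i<n. \<Sum>j<n. if i = j then ((cmod (y j))\<^sup>2 + (cmod (x j))\<^sup>2) / 2 else 0)"
      by (intro sum.cong refl) simp
    also have "\<dots> = (\<Sum>i<n. ((cmod (y i))\<^sup>2 + (cmod (x i))\<^sup>2) / 2)"
      by (intro sum.cong refl) (simp only: sum.delta' finite_lessThan, simp)
    finally show ?thesis by (simp add: s_def sq_norm_def sum.distrib sum_divide_distrib add_divide_distrib)
  qed
  also have "s + (\<Sum>i<n. \<Sum>j<n. cmod (A i j - of_bool (i = j))) * s \<le> s + e * s"
    using near s by (intro add_left_mono mult_right_mono)
  finally have le: "(\<Sum>i<n. \<Sum>j<n. Re (cnj (y i) * A i j * x j)) \<le> (1 + e) * s" by (simp add: algebra_simps)
  let ?M = "mat n n (\<lambda>(i, j). A i j / of_real (1 + e))"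
  have "mat_form ?M y x = (\<Sum>i<n. \<Sum>j<n. cnj (y i) * A i j * x j) / of_real (1 + e)"
    by (simp add: mat_form_def sum_divide_distrib)
  then have "Re (mat_form ?M y x) = (\<Sum>i<n. \<Sum>j<n. Re (cnj (y i) * A i j * x j)) / (1 + e)"
    by (simp only: Re_divide_of_real Re_sum)
  also have "\<dots> \<le> s" using le \<open>0 \<le> e\<close> by (simp add: divide_le_eq mult.commute)
  finally show "Re (mat_form ?M y x) \<le> (sq_norm (dim_row ?M) y + sq_norm (dim_col ?M) x) / 2"
    by (simp add: s_def)
qed

lemma sum_coordinates:
  fixes F :: "nat \<times> nat + (nat \<times> nat + (nat \<times> nat) \<times> 'w) \<Rightarrow> 'a::comm_monoid_add"
  assumes "finite W"
  shows "sum F (({..<n} \<times> {..<n}) <+> (({..<m} \<times> {..<m}) <+> (({..<n} \<times> {..<m}) \<times> W))) =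
    (\<Sum>i<n. \<Sum>j<n. F (Inl (i, j))) + ((\<Sum>i<m. \<Sum>j<m. F (Inr (Inl (i, j)))) +
    (\<Sum>i<n. \<Sum>j<m. \<Sum>w\<in>W. F (Inr (Inr ((i, j), w)))))"
  using assms by (simp add: sum.Plus sum.cartesian_product' o_def)

text \<open>
  The point \<open>(1, 1, v0)\<close> is separated from the convex cone of all
  \<open>(\<Sum> \<alpha>\<^sub>k\<^sup>* \<alpha>\<^sub>k, \<Sum> \<beta>\<^sub>k\<^sup>* \<beta>\<^sub>k, \<Sum> \<alpha>\<^sub>k\<^sup>* v\<^sub>k \<beta>\<^sub>k)\<close>, the last entry being seen through
  finitely many functionals that witness \<open>v0 \<notin> K\<close>.
\<close>

lemma (in duality) separating_functional:
  assumes K: "closed_rect_matrix_convex scaleV pair K" and nm: "0 < n" "0 < m"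
    and v0: "v0 \<in> carrier_mat n m" "v0 \<notin> K n m"
  obtains a b f where
    "\<And>r s v \<alpha> \<beta>. 0 < r \<Longrightarrow> 0 < s \<Longrightarrow> v \<in> K r s \<Longrightarrow>
       Re (\<Sum>i<n. \<Sum>j<m. \<Sum>c<r. \<Sum>d<s. cnj (\<alpha> c i) * \<beta> d j * pair (v $$ (c, d)) (f i j)) \<le>
       Re (\<Sum>i<n. \<Sum>j<n. a i j * (\<Sum>c<r. cnj (\<alpha> c i) * \<alpha> c j)) +
       Re (\<Sum>i<m. \<Sum>j<m. b i j * (\<Sum>d<s. cnj (\<beta> d i) * \<beta> d j))"
    "Re (\<Sum>i<n. a i i) + Re (\<Sum>i<m. b i i) < Re (\<Sum>i<n. \<Sum>j<m. pair (v0 $$ (i, j)) (f i j))"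
proof -
  have convex: "rect_matrix_convex scaleV K" and "closedin (weak_mat_topology pair n m) (K n m)"
    using K nm by (auto simp: closed_rect_matrix_convex_def)
  then have "openin (weak_mat_topology pair n m) (carrier_mat n m - K n m)"
    by (metis closedin_def topspace_weak_mat_topology)
  then obtain W \<epsilon> where W: "finite W" "0 < \<epsilon>" and nbhd: "\<And>v. v \<in> carrier_mat n m \<Longrightarrow>
      (\<And>i j w. i < n \<Longrightarrow> j < m \<Longrightarrow> w \<in> W \<Longrightarrow> cmod (pair (v $$ (i, j)) w - pair (v0 $$ (i, j)) w) < \<epsilon>) \<Longrightarrow>
      v \<in> carrier_mat n m - K n m"
    using v0 by (elim openin_weak_mat_topology_imp_nbhd[of pair n m _ v0]) auto
  have K_carrier: "v \<in> carrier_mat r s" if "0 < r" "0 < s" "v \<in> K r s" for v r s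
    using convex that by (auto simp: rect_matrix_convex_def mat_collection_def)
  \<comment> \<open>The three blocks are the entries of the two Gram sums and the values of the
    compressed matrix on the finitely many functionals in \<open>W\<close>.\<close>
  define J where "J = ({..<n} \<times> {..<n}) <+> (({..<m} \<times> {..<m}) <+> (({..<n} \<times> {..<m}) \<times> W))"
  have J: "finite J" using W by (simp add: J_def)
  define g :: "nat \<times> nat \<times> (nat \<Rightarrow> nat \<Rightarrow> complex) \<times> (nat \<Rightarrow> nat \<Rightarrow> complex) \<times> 'v mat \<Rightarrow>
      nat \<times> nat + (nat \<times> nat + (nat \<times> nat) \<times> 'w) \<Rightarrow> complex" where
    "g = (\<lambda>(r, s, \<alpha>, \<beta>, v). case_sum (\<lambda>(i, j). \<Sum>c<r. cnj (\<alpha> c i) * \<alpha> c j)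
      (case_sum (\<lambda>(i, j). \<Sum>d<s. cnj (\<beta> d i) * \<beta> d j)
        (\<lambda>((i, j), w). \<Sum>c<r. \<Sum>d<s. cnj (\<alpha> c i) * \<beta> d j * pair (v $$ (c, d)) w)))"
  define Z where "Z = {(r, s, \<alpha> :: nat \<Rightarrow> nat \<Rightarrow> complex, \<beta> :: nat \<Rightarrow> nat \<Rightarrow> complex, v). 0 < r \<and> 0 < s \<and> v \<in> K r s}"
  \<comment> \<open>With finite lists, closure under addition is concatenation, and the empty list
    gives \<open>0\<close>.\<close>
  define C where "C = {sum_list (map g zs) | zs. set zs \<subseteq> Z}"
  define x0 :: "nat \<times> nat + (nat \<times> nat + (nat \<times> nat) \<times> 'w) \<Rightarrow> complex" where
    "x0 = case_sum (\<lambda>(i, j). of_bool (i = j)) (case_sum (\<lambda>(i, j). of_bool (i = j)) (\<lambda>((i, j), w). pair (v0 $$ (i, j)) w))"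
  have C0: "0 \<in> C" unfolding C_def by (auto intro!: exI[of _ "[]"])
  have C_add: "c + d \<in> C" if cd: "c \<in> C" "d \<in> C" for c d
  proof -
    obtain zs zs' where "c = sum_list (map g zs)" "set zs \<subseteq> Z" "d = sum_list (map g zs')" "set zs' \<subseteq> Z"
      using cd by (auto simp: C_def)
    then show ?thesis unfolding C_def by (auto intro!: exI[of _ "zs @ zs'"])
  qed
  have C_scale: "t *\<^sub>R c \<in> C" if t: "0 < t" and c: "c \<in> C" for t c
  proof -
    obtain zs where zs: "c = sum_list (map g zs)" "set zs \<subseteq> Z" using c by (auto simp: C_def)
    \<comment> \<open>All coordinates of \<open>g\<close> are quadratic in the pair of coefficients,
      so a factor \<open>sqrt t\<close> on both scales the point by \<open>t\<close>.\<close>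
    define q where "q = complex_of_real (sqrt t)"
    have q: "cnj q = q" "q * q = of_real t" using t by (simp_all add: q_def flip: of_real_mult)
    define h where "h = (\<lambda>(r :: nat, s :: nat, \<alpha>, \<beta>, v :: 'v mat).
      (r, s, \<lambda>(c :: nat) (i :: nat). q * \<alpha> c i, \<lambda>(d :: nat) (j :: nat). q * \<beta> d j, v))"
    have qq: "(q * u) * (q * u') = of_real t * (u * u')" for u u' by (simp add: q(2)[symmetric] mult_ac)
    have "g (h z) k = t *\<^sub>R g z k" for z k
    proof -
      obtain r s \<alpha> \<beta> v where z: "z = (r, s, \<alpha>, \<beta>, v)" by (cases z)
      show ?thesis
        unfolding z h_def g_def prod.case complex_cnj_mult q(1) qq
        by (auto split: sum.split simp: scaleR_conv_of_real sum_distrib_left mult.assoc)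
    qed
    then have "g (h z) = t *\<^sub>R g z" for z by (simp add: fun_eq_iff)
    then have "t *\<^sub>R c = sum_list (map g (map h zs))"
      unfolding zs(1) by (induction zs) (auto simp: scaleR_add_right)
    moreover have "set (map h zs) \<subseteq> Z" using zs(2) by (auto simp: Z_def h_def)
    ultimately show ?thesis unfolding C_def by blast
  qed
  define M where "M = (\<Sum>k\<in>J. cmod (x0 k))"
  have M: "0 \<le> M" by (simp add: M_def sum_nonneg)
  \<comment> \<open>Chosen so that \<open>e + e * M = \<epsilon>\<close>: the first \<open>e\<close>
    pays for the distance to \<open>x0\<close>, and \<open>e * M\<close> for dividing by
    \<open>1 + e\<close>.\<close>
  define e where "e = \<epsilon> / (1 + M)"
  have e: "0 < e" using W M by (simp add: e_def)
  \<comment> \<open>A cone point within \<open>e\<close> of \<open>x0\<close> would, after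
    renormalization of its coefficients, give a matrix convex combination of elements of
    \<open>K\<close> inside the neighbourhood of \<open>v0\<close> that misses
    \<open>K\<close>.\<close>
  have gap: "e \<le> (\<Sum>k\<in>J. cmod (c k - x0 k))" if c: "c \<in> C" for c
  proof (rule ccontr)
    assume "\<not> ?thesis"
    then have small: "(\<Sum>k\<in>J. cmod (c k - x0 k)) < e" by simp
    obtain zs where zs: "c = sum_list (map g zs)" "set zs \<subseteq> Z" using c by (auto simp: C_def)
    define l where "l = length zs"
    have "\<exists>r s \<alpha> \<beta> v. 0 < r \<and> 0 < s \<and> v \<in> K r s \<and> g (zs ! k) = g (r, s, \<alpha>, \<beta>, v)" if "k < l" for k
    proof -
      have "zs ! k \<in> Z" using zs(2) that by (auto simp: l_def)
      moreover obtain r s \<alpha> \<beta> v where "zs ! k = (r, s, \<alpha>, \<beta>, v)" by (cases "zs ! k")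
      ultimately have "0 < r \<and> 0 < s \<and> v \<in> K r s \<and> g (zs ! k) = g (r, s, \<alpha>, \<beta>, v)" by (simp add: Z_def)
      then show ?thesis by blast
    qed
    then obtain R S \<alpha> \<beta> v where fam: "\<And>k. k < l \<Longrightarrow> 0 < R k \<and> 0 < S k \<and> v k \<in> K (R k) (S k)"
      and gz: "\<And>k. k < l \<Longrightarrow> g (zs ! k) = g (R k, S k, \<alpha> k, \<beta> k, v k)" by metis
    have "c = (\<Sum>k<l. g (R k, S k, \<alpha> k, \<beta> k, v k))"
      unfolding zs(1) sum_list_sum_nth by (simp add: l_def[symmetric] gz lessThan_atLeast0)
    then have c_eq: "c x = (\<Sum>k<l. g (R k, S k, \<alpha> k, \<beta> k, v k) x)" for x by (simp add: sum_fun_apply)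
    have c1: "c (Inl (i, j)) = (\<Sum>k<l. \<Sum>c<R k. cnj (\<alpha> k c i) * \<alpha> k c j)"
      and c2: "c (Inr (Inl (i, j))) = (\<Sum>k<l. \<Sum>d<S k. cnj (\<beta> k d i) * \<beta> k d j)"
      and c3: "c (Inr (Inr ((i, j), w))) =
        (\<Sum>k<l. \<Sum>c<R k. \<Sum>d<S k. cnj (\<alpha> k c i) * \<beta> k d j * pair (v k $$ (c, d)) w)" for i j w
      unfolding c_eq by (simp_all add: g_def)
    \<comment> \<open>The factor \<open>1 / (1 + e)\<close> that makes both Gram sums contractive is
      shared equally by the two factors of each product.\<close>
    define q where "q = complex_of_real (1 / sqrt (1 + e))"
    have q: "cnj q = q" "q * q = 1 / of_real (1 + e)"
      using e by (simp_all add: q_def flip: of_real_mult)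
    have qq: "(q * u) * (q * u') = (u * u') / of_real (1 + e)" for u u'
      using q(2) by (metis (no_types, opaque_lifting) mult.assoc mult.commute mult_1 times_divide_eq_left)
    define \<alpha>' where "\<alpha>' k = mat (R k) n (\<lambda>(c, i). q * \<alpha> k c i)" for k
    define \<beta>' where "\<beta>' k = mat (S k) m (\<lambda>(d, j). q * \<beta> k d j)" for k
    have \<alpha>': "\<alpha>' k \<in> carrier_mat (R k) n" and \<beta>': "\<beta>' k \<in> carrier_mat (S k) m" for k
      by (simp_all add: \<alpha>'_def \<beta>'_def)
    have gram\<alpha>: "mat_family_sum n n l (\<lambda>k. mat_adjoint (\<alpha>' k) * \<alpha>' k) =
        mat n n (\<lambda>(i, j). c (Inl (i, j)) / of_real (1 + e))"
    proof (rule eq_matI, goal_cases)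
      case (1 i j)
      then have "mat_family_sum n n l (\<lambda>k. mat_adjoint (\<alpha>' k) * \<alpha>' k) $$ (i, j) =
          (\<Sum>k<l. \<Sum>c<R k. cnj (\<alpha>' k $$ (c, i)) * \<alpha>' k $$ (c, j))"
        by (intro index_gram_sum \<alpha>') auto
      also have "\<dots> = (\<Sum>k<l. \<Sum>c<R k. (cnj (\<alpha> k c i) * \<alpha> k c j) / of_real (1 + e))"
        using 1 by (intro sum.cong refl) (simp add: \<alpha>'_def q(1) qq del: of_real_add)
      finally show ?case using 1 by (simp add: c1 sum_divide_distrib)
    qed (simp_all add: mat_family_sum_def)
    have gram\<beta>: "mat_family_sum m m l (\<lambda>k. mat_adjoint (\<beta>' k) * \<beta>' k) =
        mat m m (\<lambda>(i, j). c (Inr (Inl (i, j))) / of_real (1 + e))"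
    proof (rule eq_matI, goal_cases)
      case (1 i j)
      then have "mat_family_sum m m l (\<lambda>k. mat_adjoint (\<beta>' k) * \<beta>' k) $$ (i, j) =
          (\<Sum>k<l. \<Sum>c<S k. cnj (\<beta>' k $$ (c, i)) * \<beta>' k $$ (c, j))"
        by (intro index_gram_sum \<beta>') auto
      also have "\<dots> = (\<Sum>k<l. \<Sum>c<S k. (cnj (\<beta> k c i) * \<beta> k c j) / of_real (1 + e))"
        using 1 by (intro sum.cong refl) (simp add: \<beta>'_def q(1) qq del: of_real_add)
      finally show ?case using 1 by (simp add: c2 sum_divide_distrib)
    qed (simp_all add: mat_family_sum_def)
    note dist = small[unfolded J_def sum_coordinates[OF W(1)]]
    have nonneg: "0 \<le> (\<Sum>i<n. \<Sum>j<n. cmod (c (Inl (i, j)) - x0 (Inl (i, j))))"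
      "0 \<le> (\<Sum>i<m. \<Sum>j<m. cmod (c (Inr (Inl (i, j))) - x0 (Inr (Inl (i, j)))))"
      "0 \<le> (\<Sum>i<n. \<Sum>j<m. \<Sum>w\<in>W. cmod (c (Inr (Inr ((i, j), w))) - x0 (Inr (Inr ((i, j), w)))))"
      by (intro sum_nonneg norm_ge_zero)+
    have norm\<alpha>: "mat_op_norm (mat_family_sum n n l (\<lambda>k. mat_adjoint (\<alpha>' k) * \<alpha>' k)) \<le> 1"
      unfolding gram\<alpha> using dist nonneg e
      by (intro mat_op_norm_near_identity_le_1[where A = "\<lambda>i j. c (Inl (i, j))"]) (simp_all add: x0_def)
    have norm\<beta>: "mat_op_norm (mat_family_sum m m l (\<lambda>k. mat_adjoint (\<beta>' k) * \<beta>' k)) \<le> 1"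
      unfolding gram\<beta> using dist nonneg e
      by (intro mat_op_norm_near_identity_le_1[where A = "\<lambda>i j. c (Inr (Inl (i, j)))"]) (simp_all add: x0_def)
    define u where "u = mat_family_sum n m l (\<lambda>k. mat_compression scaleV (\<alpha>' k) (v k) (\<beta>' k))"
    have "u \<in> K n m"
    proof -
      have "mat_op_norm (mat_family_sum n n l (\<lambda>k. mat_adjoint (\<alpha>' k) * \<alpha>' k)) *
          mat_op_norm (mat_family_sum m m l (\<lambda>k. mat_adjoint (\<beta>' k) * \<beta>' k)) \<le> 1"
        using norm\<alpha> norm\<beta> by (intro mult_le_one mat_op_norm_nonneg)
      then show ?thesis
        unfolding u_def using convex[unfolded rect_matrix_convex_def, THEN conjunct2, rule_format, OF nm, of l R S \<alpha>' \<beta>' v]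
          fam \<alpha>' \<beta>' by blast
    qed
    moreover have "cmod (pair (u $$ (i, j)) w - pair (v0 $$ (i, j)) w) < \<epsilon>" if ijw: "i < n" "j < m" "w \<in> W" for i j w
    proof -
      let ?k = "Inr (Inr ((i, j), w))"
      have k: "?k \<in> J" using ijw by (auto simp: J_def)
      have "pair (u $$ (i, j)) w =
          (\<Sum>k<l. \<Sum>c<R k. \<Sum>d<S k. cnj (\<alpha>' k $$ (c, i)) * \<beta>' k $$ (d, j) * pair (v k $$ (c, d)) w)"
        unfolding u_def using fam \<alpha>' \<beta>' K_carrier ijw
        by (intro pair_family_sum_compression) auto
      also have "\<dots> = (\<Sum>k<l. \<Sum>c<R k. \<Sum>d<S k. (cnj (\<alpha> k c i) * \<beta> k d j * pair (v k $$ (c, d)) w) / of_real (1 + e))"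
        using ijw by (intro sum.cong refl) (simp add: \<alpha>'_def \<beta>'_def q(1) qq del: of_real_add)
      also have "\<dots> = c ?k / of_real (1 + e)" by (simp add: c3 sum_divide_distrib)
      also have "\<dots> - pair (v0 $$ (i, j)) w = ((c ?k - x0 ?k) - of_real e * x0 ?k) / of_real (1 + e)"
      proof -
        have "z / d - u = ((z - u) - (d - 1) * u) / d" if "d \<noteq> 0" for z u d :: complex
          using that by (simp add: field_simps)
        moreover have "complex_of_real (1 + e) \<noteq> 0" "complex_of_real e = complex_of_real (1 + e) - 1"
          using e by (simp_all only: of_real_eq_0_iff) simp_all
        ultimately show ?thesis by (simp only: x0_def sum.case prod.case)
      qed
      finally have "cmod (pair (u $$ (i, j)) w - pair (v0 $$ (i, j)) w) =
          cmod ((c ?k - x0 ?k) - of_real e * x0 ?k) / (1 + e)"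
        using e by (simp add: norm_divide del: of_real_add)
      also have "\<dots> \<le> cmod ((c ?k - x0 ?k) - of_real e * x0 ?k)" using e by (simp add: divide_le_eq mult_le_cancel_left1)
      also have "\<dots> \<le> cmod (c ?k - x0 ?k) + e * cmod (x0 ?k)"
        using norm_triangle_ineq4[of "c ?k - x0 ?k" "of_real e * x0 ?k"] e by (simp add: norm_mult)
      also have "\<dots> \<le> (\<Sum>k\<in>J. cmod (c k - x0 k)) + e * M"
        unfolding M_def using k J e by (intro add_mono mult_left_mono member_le_sum) auto
      also have "\<dots> < e + e * M" using small by simp
      also have "e + e * M = e * (1 + M)" by (simp add: distrib_left)
      also have "\<dots> = \<epsilon>" using M by (simp add: e_def)
      finally show ?thesis .
    qed
    moreover have "u \<in> carrier_mat n m" by (simp add: u_def mat_family_sum_def)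
    ultimately show False using nbhd[of u] by blast
  qed
  obtain t where t: "\<And>c. c \<in> C \<Longrightarrow> 0 \<le> Re (\<Sum>k\<in>J. t k * c k)" "Re (\<Sum>k\<in>J. t k * x0 k) < 0"
    using cone_separation[OF J C0 C_add C_scale e gap] by blast
  \<comment> \<open>The sign converts nonnegativity on the cone into an upper bound of the pairing
    part by the two Gram parts.\<close>
  define f where "f i j = - (\<Sum>w\<in>W. scaleV' (t (Inr (Inr ((i, j), w)))) w)" for i j
  have pair_f: "pair v (f i j) = - (\<Sum>w\<in>W. t (Inr (Inr ((i, j), w))) * pair v w)" for v i j
    by (simp add: f_def pair_minus_right pair_sum_right pair_scale_right)
  show thesis
  proof
    fix r s v and \<alpha> \<beta> :: "nat \<Rightarrow> nat \<Rightarrow> complex"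
    assume "0 < r" "0 < s" "v \<in> K r s"
    then have "g (r, s, \<alpha>, \<beta>, v) \<in> C" unfolding C_def
      by (auto simp: Z_def intro!: exI[of _ "[(r, s, \<alpha>, \<beta>, v)]"])
    from t(1)[OF this, unfolded J_def sum_coordinates[OF W(1)]]
    have "0 \<le> Re ((\<Sum>i<n. \<Sum>j<n. t (Inl (i, j)) * (\<Sum>c<r. cnj (\<alpha> c i) * \<alpha> c j)) +
        ((\<Sum>i<m. \<Sum>j<m. t (Inr (Inl (i, j))) * (\<Sum>d<s. cnj (\<beta> d i) * \<beta> d j)) +
         (\<Sum>i<n. \<Sum>j<m. \<Sum>w\<in>W. t (Inr (Inr ((i, j), w))) *
            (\<Sum>c<r. \<Sum>d<s. cnj (\<alpha> c i) * \<beta> d j * pair (v $$ (c, d)) w))))"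
      by (simp only: g_def prod.case sum.case)
    moreover have "(\<Sum>i<n. \<Sum>j<m. \<Sum>c<r. \<Sum>d<s. cnj (\<alpha> c i) * \<beta> d j * pair (v $$ (c, d)) (f i j)) =
        - (\<Sum>i<n. \<Sum>j<m. \<Sum>w\<in>W. t (Inr (Inr ((i, j), w))) *
            (\<Sum>c<r. \<Sum>d<s. cnj (\<alpha> c i) * \<beta> d j * pair (v $$ (c, d)) w))"
      unfolding sum_negf[symmetric]
    proof (intro sum.cong refl)
      fix i j
      have "(\<Sum>c<r. \<Sum>d<s. cnj (\<alpha> c i) * \<beta> d j * pair (v $$ (c, d)) (f i j)) =
          (\<Sum>c<r. \<Sum>d<s. \<Sum>w\<in>W. - (t (Inr (Inr ((i, j), w))) * (cnj (\<alpha> c i) * \<beta> d j * pair (v $$ (c, d)) w)))"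
        unfolding pair_f by (intro sum.cong refl) (simp add: sum_distrib_left sum_negf mult_ac)
      also have "\<dots> = (\<Sum>w\<in>W. \<Sum>c<r. \<Sum>d<s. - (t (Inr (Inr ((i, j), w))) * (cnj (\<alpha> c i) * \<beta> d j * pair (v $$ (c, d)) w)))"
        by (rule sum_swap_last)
      finally show "(\<Sum>c<r. \<Sum>d<s. cnj (\<alpha> c i) * \<beta> d j * pair (v $$ (c, d)) (f i j)) =
          (\<Sum>w\<in>W. - (t (Inr (Inr ((i, j), w))) * (\<Sum>c<r. \<Sum>d<s. cnj (\<alpha> c i) * \<beta> d j * pair (v $$ (c, d)) w)))"
        by (simp add: sum_distrib_left sum_negf)
    qed
    ultimately show "Re (\<Sum>i<n. \<Sum>j<m. \<Sum>c<r. \<Sum>d<s. cnj (\<alpha> c i) * \<beta> d j * pair (v $$ (c, d)) (f i j)) \<le>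
       Re (\<Sum>i<n. \<Sum>j<n. t (Inl (i, j)) * (\<Sum>c<r. cnj (\<alpha> c i) * \<alpha> c j)) +
       Re (\<Sum>i<m. \<Sum>j<m. t (Inr (Inl (i, j))) * (\<Sum>d<s. cnj (\<beta> d i) * \<beta> d j))"
      by (simp only: plus_complex.simps uminus_complex.simps)
  next
    have diag: "(\<Sum>i<k. \<Sum>j<k. a i j * of_bool (i = j)) = (\<Sum>i<k. a i i)" for a :: "nat \<Rightarrow> nat \<Rightarrow> complex" and k
    proof (intro sum.cong refl)
      fix i assume "i \<in> {..<k}"
      have "(\<Sum>j<k. a i j * of_bool (i = j)) = (\<Sum>j<k. if i = j then a i j else 0)"
        by (intro sum.cong refl) simp
      also have "\<dots> = a i i" using \<open>i \<in> {..<k}\<close> by (simp only: sum.delta' finite_lessThan if_True)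
      finally show "(\<Sum>j<k. a i j * of_bool (i = j)) = a i i" .
    qed
    show "Re (\<Sum>i<n. t (Inl (i, i))) + Re (\<Sum>i<m. t (Inr (Inl (i, i)))) <
        Re (\<Sum>i<n. \<Sum>j<m. pair (v0 $$ (i, j)) (f i j))"
      using t(2)[unfolded J_def sum_coordinates[OF W(1)]]
      by (simp only: x0_def prod.case sum.case diag pair_f sum_negf plus_complex.simps uminus_complex.simps)
  qed
qed

text \<open>Substituting \<open>G y\<close> and \<open>G' x\<close> for the coefficients bounds the
  two forms by the squared norms of \<open>y\<close> and \<open>x\<close>, so the separating
  inequality becomes contractivity on \<open>K\<close>.\<close>

lemma (in duality) contractive_functional:
  assumes K: "closed_rect_matrix_convex scaleV pair K" and nm: "0 < n" "0 < m"
    and v0: "v0 \<in> carrier_mat n m" "v0 \<notin> K n m"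
  obtains f where "f \<in> carrier_mat n m" "\<not> pairing_contractive pair v0 f"
    "\<And>r s v. 0 < r \<Longrightarrow> 0 < s \<Longrightarrow> v \<in> K r s \<Longrightarrow> pairing_contractive pair v f"
proof -
  obtain a b f where
    le: "\<And>r s v \<alpha> \<beta>. 0 < r \<Longrightarrow> 0 < s \<Longrightarrow> v \<in> K r s \<Longrightarrow>
       Re (\<Sum>i<n. \<Sum>j<m. \<Sum>c<r. \<Sum>d<s. cnj (\<alpha> c i) * \<beta> d j * pair (v $$ (c, d)) (f i j)) \<le>
       Re (\<Sum>i<n. \<Sum>j<n. a i j * (\<Sum>c<r. cnj (\<alpha> c i) * \<alpha> c j)) +
       Re (\<Sum>i<m. \<Sum>j<m. b i j * (\<Sum>d<s. cnj (\<beta> d i) * \<beta> d j))"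
    and sep: "Re (\<Sum>i<n. a i i) + Re (\<Sum>i<m. b i i) < Re (\<Sum>i<n. \<Sum>j<m. pair (v0 $$ (i, j)) (f i j))"
    by (rule separating_functional[OF K nm v0]) (rule that)
  have convex: "rect_matrix_convex scaleV K"
    using K by (auto simp: closed_rect_matrix_convex_def)
  have K_carrier: "v \<in> carrier_mat r s" if "0 < r" "0 < s" "v \<in> K r s" for v r s
    using convex that by (auto simp: rect_matrix_convex_def mat_collection_def)
  define q where "q k h x = Re (\<Sum>i<k. \<Sum>j<k. h i j * cnj (x i) * x j)"
    for k :: nat and h :: "nat \<Rightarrow> nat \<Rightarrow> complex" and x :: "nat \<Rightarrow> complex"
  have q_sum: "Re (\<Sum>i<k. \<Sum>j<k. h i j * (\<Sum>c<r. cnj (\<alpha> c i) * \<alpha> c j)) = (\<Sum>c<r. q k h (\<alpha> c))"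
    for k r :: nat and h and \<alpha> :: "nat \<Rightarrow> nat \<Rightarrow> complex"
  proof -
    have "(\<Sum>i<k. \<Sum>j<k. h i j * (\<Sum>c<r. cnj (\<alpha> c i) * \<alpha> c j)) =
        (\<Sum>i<k. \<Sum>j<k. \<Sum>c<r. h i j * cnj (\<alpha> c i) * \<alpha> c j)"
      by (simp add: sum_distrib_left mult.assoc)
    also have "\<dots> = (\<Sum>c<r. \<Sum>i<k. \<Sum>j<k. h i j * cnj (\<alpha> c i) * \<alpha> c j)" by (rule sum_swap_last)
    finally show ?thesis by (simp only: q_def Re_sum)
  qed
  \<comment> \<open>The empty family puts the zero matrix into \<open>K 1 1\<close>. With some
    element of \<open>K\<close> at hand, setting one coefficient in \<open>le\<close> to zero shows
    that the other form is nonnegative.\<close>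
  have "mat_op_norm (mat_family_sum 1 1 0 A) \<le> 1" for A :: "nat \<Rightarrow> complex mat"
    unfolding mat_op_norm_le_1_iff by (simp add: mat_form_def mat_family_sum_def sq_norm_nonneg)
  then have "mat_op_norm (mat_family_sum 1 1 0 A) * mat_op_norm (mat_family_sum 1 1 0 B) \<le> 1"
    for A B :: "nat \<Rightarrow> complex mat" by (intro mult_le_one mat_op_norm_nonneg)
  then have "mat_family_sum 1 1 0 (\<lambda>i. mat_compression scaleV (\<alpha> i) (v i) (\<beta> i)) \<in> K 1 1" for \<alpha> \<beta> v
    using convex[unfolded rect_matrix_convex_def, THEN conjunct2, rule_format, of 1 1 0] by auto
  then obtain z where z: "z \<in> K 1 1" by blast
  have q_a: "0 \<le> q n a x" for x
    using le[OF _ _ z, of "\<lambda>_. x" "\<lambda>_ _. 0"] unfolding q_sum by (simp add: q_def)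
  have q_b: "0 \<le> q m b x" for x
    using le[OF _ _ z, of "\<lambda>_ _. 0" "\<lambda>_. x"] unfolding q_sum by (simp add: q_def)
  define gap where "gap = Re (\<Sum>i<n. \<Sum>j<m. pair (v0 $$ (i, j)) (f i j)) - (Re (\<Sum>i<n. a i i) + Re (\<Sum>i<m. b i i))"
  \<comment> \<open>The perturbation raises the two traces by
    \<open>\<delta> * n + \<delta> * m = gap / 2\<close> in total, so the separation stays
    strict.\<close>
  define \<delta> where "\<delta> = gap / 2 / (real n + real m)"
  have gap: "0 < gap" using sep by (simp only: gap_def diff_gt_0_iff_gt)
  then have \<delta>: "0 < \<delta>" using nm by (simp add: \<delta>_def)
  have "\<delta> * (real n + real m) = gap / 2"
    unfolding \<delta>_def using nm by (subst nonzero_eq_divide_eq[symmetric]) simp_all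
  then have \<delta>_gap: "\<delta> * n + \<delta> * m < gap" using gap unfolding distrib_left by linarith
  obtain R G where R: "\<And>x. q n a x + \<delta> * sq_norm n x = sq_norm n (\<lambda>i. \<Sum>j<n. R i j * x j)"
    and RG: "\<And>i k. i < n \<Longrightarrow> k < n \<Longrightarrow> (\<Sum>j<n. R i j * G j k) = of_bool (i = k)"
    and GR: "\<And>i k. i < n \<Longrightarrow> k < n \<Longrightarrow> (\<Sum>j<n. G i j * R j k) = of_bool (i = k)"
    using nonneg_form_factorization[OF q_a[unfolded q_def] \<delta>] unfolding q_def by blast
  obtain R' G' where R': "\<And>x. q m b x + \<delta> * sq_norm m x = sq_norm m (\<lambda>i. \<Sum>j<m. R' i j * x j)"
    and RG': "\<And>i k. i < m \<Longrightarrow> k < m \<Longrightarrow> (\<Sum>j<m. R' i j * G' j k) = of_bool (i = k)"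
    and GR': "\<And>i k. i < m \<Longrightarrow> k < m \<Longrightarrow> (\<Sum>j<m. G' i j * R' j k) = of_bool (i = k)"
    using nonneg_form_factorization[OF q_b[unfolded q_def] \<delta>] unfolding q_def by blast
  \<comment> \<open>This is \<open>f\<close> compressed by the inverses \<open>G\<close> and
    \<open>G'\<close>; the factor \<open>1 / 2\<close> matches the arithmetic mean in
    \<open>pairing_contractive\<close>.\<close>
  define F where "F = mat n m (\<lambda>(a, b). scaleV' (1 / 2) (\<Sum>i<n. \<Sum>j<m. scaleV' (cnj (G i a) * G' j b) (f i j)))"
  have form: "pairing_form pair v F y x = (\<Sum>i<n. \<Sum>j<m. \<Sum>c<r. \<Sum>d<s.
      cnj (\<Sum>a<n. G i a * y c a) * (\<Sum>b<m. G' j b * x d b) * pair (v $$ (c, d)) (f i j)) / 2"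
    if v: "v \<in> carrier_mat r s" for v r s y x
  proof -
    let ?t = "\<lambda>c d i j a b. cnj (G i a * y c a) * (G' j b * x d b) * pair (v $$ (c, d)) (f i j) / 2"
    have "pairing_form pair v F y x = (\<Sum>c<r. \<Sum>a<n. \<Sum>d<s. \<Sum>b<m. \<Sum>i<n. \<Sum>j<m. ?t c d i j a b)"
      unfolding pairing_form_def using v
      by (auto simp: F_def pair_scale_right pair_sum_right sum_distrib_left sum_distrib_right mult_ac
          intro!: sum.cong)
    also have "\<dots> = (\<Sum>c<r. \<Sum>d<s. \<Sum>a<n. \<Sum>b<m. \<Sum>i<n. \<Sum>j<m. ?t c d i j a b)"
      by (intro sum.cong[OF refl] sum.swap)
    also have "\<dots> = (\<Sum>c<r. \<Sum>d<s. \<Sum>i<n. \<Sum>j<m. \<Sum>a<n. \<Sum>b<m. ?t c d i j a b)"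
      by (rule sum.cong[OF refl], rule sum.cong[OF refl], rule sum_swap_pairs)
    also have "\<dots> = (\<Sum>i<n. \<Sum>j<m. \<Sum>c<r. \<Sum>d<s. \<Sum>a<n. \<Sum>b<m. ?t c d i j a b)"
      by (rule sum_swap_pairs)
    also have "\<dots> = (\<Sum>i<n. \<Sum>j<m. \<Sum>c<r. \<Sum>d<s.
      cnj (\<Sum>a<n. G i a * y c a) * (\<Sum>b<m. G' j b * x d b) * pair (v $$ (c, d)) (f i j)) / 2"
      unfolding cnj_sum sum_product unfolding sum_distrib_right sum_divide_distrib by (rule refl)
    finally show ?thesis .
  qed
  have cancel: "(\<Sum>j<k. A i j * (\<Sum>a<k. B j a * z a)) = z i"
    if "i < k" "\<And>i l. i < k \<Longrightarrow> l < k \<Longrightarrow> (\<Sum>j<k. A i j * B j l) = of_bool (i = l)"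
    for A B :: "nat \<Rightarrow> nat \<Rightarrow> complex" and z i k
  proof -
    have "(\<Sum>j<k. A i j * (\<Sum>a<k. B j a * z a)) = (\<Sum>a<k. (\<Sum>j<k. A i j * B j a) * z a)"
      unfolding sum_distrib_left sum_distrib_right mult.assoc by (rule sum.swap)
    also have "\<dots> = (\<Sum>a<k. if i = a then z a else 0)"
      using that by (intro sum.cong refl) simp
    also have "\<dots> = z i" using that(1) by (simp only: sum.delta' finite_lessThan lessThan_iff if_True)
    finally show ?thesis .
  qed
  \<comment> \<open>Dropping the nonnegative \<open>\<delta>\<close> term leaves the squared norm of
    \<open>R G z = z\<close>.\<close>
  have q_G: "q n a (\<lambda>i. \<Sum>c<n. G i c * z c) \<le> sq_norm n z" for z
  proof -
    have "sq_norm n (\<lambda>i. \<Sum>j<n. R i j * (\<Sum>c<n. G j c * z c)) = sq_norm n z"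
      unfolding sq_norm_def using cancel[OF _ RG] by (intro sum.cong refl) simp
    then show ?thesis
      using R[of "\<lambda>i. \<Sum>c<n. G i c * z c"] \<delta> sq_norm_nonneg[of n "\<lambda>i. \<Sum>c<n. G i c * z c"]
      by (smt (verit) mult_nonneg_nonneg)
  qed
  have q_G': "q m b (\<lambda>i. \<Sum>c<m. G' i c * z c) \<le> sq_norm m z" for z
  proof -
    have "sq_norm m (\<lambda>i. \<Sum>j<m. R' i j * (\<Sum>c<m. G' j c * z c)) = sq_norm m z"
      unfolding sq_norm_def using cancel[OF _ RG'] by (intro sum.cong refl) simp
    then show ?thesis
      using R'[of "\<lambda>i. \<Sum>c<m. G' i c * z c"] \<delta> sq_norm_nonneg[of m "\<lambda>i. \<Sum>c<m. G' i c * z c"]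
      by (smt (verit) mult_nonneg_nonneg)
  qed
  have sq2: "sq_norm2 r k y = (\<Sum>c<r. sq_norm k (y c))" for r k y
    by (simp add: sq_norm2_def sq_norm_def)
  show thesis
  proof
    show F: "F \<in> carrier_mat n m" by (simp add: F_def)
    show "pairing_contractive pair v F" if v: "0 < r" "0 < s" "v \<in> K r s" for r s v
      unfolding pairing_contractive_def
    proof (intro allI)
      fix y x
      have vc: "v \<in> carrier_mat r s" using K_carrier v by blast
      have "Re (pairing_form pair v F y x) \<le>
          ((\<Sum>c<r. q n a (\<lambda>i. \<Sum>a<n. G i a * y c a)) + (\<Sum>d<s. q m b (\<lambda>j. \<Sum>b<m. G' j b * x d b))) / 2"
        using le[OF v, of "\<lambda>c i. \<Sum>a<n. G i a * y c a" "\<lambda>d j. \<Sum>b<m. G' j b * x d b"]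
        unfolding form[OF vc] q_sum by simp
      also have "\<dots> \<le> (sq_norm2 r n y + sq_norm2 s m x) / 2"
        unfolding sq2 by (intro divide_right_mono add_mono sum_mono q_G q_G') simp
      finally show "Re (pairing_form pair v F y x) \<le>
          (sq_norm2 (dim_row v) (dim_row F) y + sq_norm2 (dim_col v) (dim_col F) x) / 2"
        using vc F by auto
    qed
    show "\<not> pairing_contractive pair v0 F"
    proof
      assume contr: "pairing_contractive pair v0 F"
      \<comment> \<open>The test arrays are the transposes of \<open>R\<close> and
        \<open>R'\<close>. As \<open>G R = 1\<close> and \<open>G' R' = 1\<close>, the form at them
        is half the pairing of \<open>v0\<close> with \<open>f\<close>.\<close>
      let ?y = "\<lambda>p a. R a p" and ?x = "\<lambda>q b. R' b q"
      have "pairing_form pair v0 F ?y ?x = (\<Sum>i<n. \<Sum>j<m. \<Sum>c<n. \<Sum>d<m.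
          of_bool (c = i) * (of_bool (d = j) * pair (v0 $$ (c, d)) (f i j))) / 2"
        unfolding form[OF v0(1)]
        by (intro arg_cong2[where f = "(/)"] sum.cong refl) (auto simp: GR GR')
      also have "\<dots> = (\<Sum>i<n. \<Sum>j<m. pair (v0 $$ (i, j)) (f i j)) / 2"
      proof (intro arg_cong2[where f = "(/)"] sum.cong refl)
        fix i j assume ij: "i \<in> {..<n}" "j \<in> {..<m}"
        have "(\<Sum>c<n. \<Sum>d<m. of_bool (c = i) * (of_bool (d = j) * pair (v0 $$ (c, d)) (f i j))) =
            (\<Sum>c<n. if c = i then \<Sum>d<m. if d = j then pair (v0 $$ (c, d)) (f i j) else 0 else 0)"
          by (intro sum.cong refl) (auto intro!: sum.cong)
        also have "\<dots> = pair (v0 $$ (i, j)) (f i j)"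
          using ij by (simp only: sum.delta finite_lessThan if_True)
        finally show "(\<Sum>c<n. \<Sum>d<m. of_bool (c = i) * (of_bool (d = j) * pair (v0 $$ (c, d)) (f i j))) =
            pair (v0 $$ (i, j)) (f i j)" .
      qed
      finally have lhs: "Re (pairing_form pair v0 F ?y ?x) = Re (\<Sum>i<n. \<Sum>j<m. pair (v0 $$ (i, j)) (f i j)) / 2"
        by (simp only: Re_divide_numeral)
      \<comment> \<open>Evaluating the factorization at the unit vectors gives the squared norms of
        the columns of \<open>P\<close>; they add up to the real part of the trace of
        \<open>h\<close> plus \<open>\<delta>\<close> per dimension.\<close>
      have norm_R: "sq_norm2 k k (\<lambda>p a. P a p) = Re (\<Sum>i<k. h i i) + \<delta> * k"
        if P: "\<And>x. q k h x + \<delta> * sq_norm k x = sq_norm k (\<lambda>i. \<Sum>j<k. P i j * x j)" for k h P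
      proof -
        have "sq_norm k (\<lambda>a. P a p) = Re (h p p) + \<delta>" if "p < k" for p
        proof -
          have "(\<Sum>j<k. z j * of_bool (j = p)) = z p" for z :: "nat \<Rightarrow> complex"
          proof -
            have "(\<Sum>j<k. z j * of_bool (j = p)) = (\<Sum>j<k. if j = p then z j else 0)"
              by (intro sum.cong refl) simp
            then show ?thesis using that by simp
          qed
          note pick = this
          have "cnj (of_bool P) = of_bool P" for P by simp
          then have "q k h (\<lambda>j. of_bool (j = p)) = Re (h p p)" unfolding q_def by (simp only: pick)
          moreover have "sq_norm k (\<lambda>j. of_bool (j = p)) = 1"
          proof -
            have "sq_norm k (\<lambda>j. of_bool (j = p)) = (\<Sum>j<k. if j = p then 1 else 0)"
              unfolding sq_norm_def by (intro sum.cong refl) simp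
            then show ?thesis using that by simp
          qed
          ultimately show ?thesis using P[of "\<lambda>j. of_bool (j = p)"] unfolding pick by simp
        qed
        then show ?thesis by (simp add: sq2 sum.distrib)
      qed
      have "Re (\<Sum>i<n. \<Sum>j<m. pair (v0 $$ (i, j)) (f i j)) \<le> sq_norm2 n n ?y + sq_norm2 m m ?x"
        using contr[unfolded pairing_contractive_def, rule_format, of ?y ?x] v0(1) F unfolding lhs by auto
      also have "\<dots> = (Re (\<Sum>i<n. a i i) + \<delta> * n) + (Re (\<Sum>i<m. b i i) + \<delta> * m)"
        using norm_R[OF R] norm_R[OF R'] by simp
      finally show False using \<delta>_gap unfolding gap_def by simp
    qed
  qed
qed

section \<open>The hull property of the bipolar\<close>

theorem theorem3p4:
  fixes scaleV :: "complex \<Rightarrow> 'v::ab_group_add \<Rightarrow> 'v"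
    and scaleV' :: "complex \<Rightarrow> 'w::ab_group_add \<Rightarrow> 'w"
    and pair :: "'v \<Rightarrow> 'w \<Rightarrow> complex"
    and S :: "nat \<Rightarrow> nat \<Rightarrow> 'v mat set"
  assumes "duality scaleV scaleV' pair"
    and "mat_collection S"
  shows "is_closed_rect_matrix_convex_hull scaleV pair S (rect_matrix_bipolar pair S)"
proof -
  interpret duality scaleV scaleV' pair by (rule assms(1))
  have S_carrier: "v \<in> carrier_mat r s" if "0 < r" "0 < s" "v \<in> S r s" for v r s
    using assms(2) that by (auto simp: mat_collection_def)
  have polar: "f \<in> rect_matrix_polar pair S r s \<longleftrightarrow> f \<in> carrier_mat r s \<and>
      (\<forall>n>0. \<forall>m>0. \<forall>v\<in>S n m. pairing_contractive pair v f)" if "0 < r" "0 < s" for f r s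
    using that by (auto simp: rect_matrix_polar_def mat_op_norm_mat_pairing_le_1_iff)
  show ?thesis
    unfolding is_closed_rect_matrix_convex_hull_def rect_matrix_bipolar_def
  proof (intro conjI allI impI)
    show "closed_rect_matrix_convex scaleV pair (rect_matrix_polar (\<lambda>f v. pair v f) (rect_matrix_polar pair S))"
      unfolding closed_rect_matrix_convex_def by (simp add: rect_matrix_convex_polar closedin_polar)
    show "collection_le S (rect_matrix_polar (\<lambda>f v. pair v f) (rect_matrix_polar pair S))"
      unfolding collection_le_def
    proof (intro allI impI subsetI)
      fix n m v assume nm: "0 < n" "0 < m" and v: "v \<in> S n m"
      then show "v \<in> rect_matrix_polar (\<lambda>f v. pair v f) (rect_matrix_polar pair S) n m"
        using S_carrier[OF nm v] by (auto simp: polar_eq polar)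
    qed
    fix K assume K: "closed_rect_matrix_convex scaleV pair K \<and> collection_le S K"
    show "collection_le (rect_matrix_polar (\<lambda>f v. pair v f) (rect_matrix_polar pair S)) K"
      unfolding collection_le_def
    proof (intro allI impI subsetI, rule ccontr)
      fix n m v assume nm: "0 < n" "0 < m" and nK: "v \<notin> K n m"
        and v: "v \<in> rect_matrix_polar (\<lambda>f v. pair v f) (rect_matrix_polar pair S) n m"
      have v_carrier: "v \<in> carrier_mat n m" using v by (simp add: rect_matrix_polar_def)
      \<comment> \<open>The separating \<open>f\<close> is contractive on all of \<open>K\<close>,
        hence on \<open>S\<close>. It thus lies in the polar of \<open>S\<close>, and an element of
        the bipolar must pair contractively with it.\<close>
      obtain f where f: "f \<in> carrier_mat n m" "\<not> pairing_contractive pair v f"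
        "\<And>r s v. 0 < r \<Longrightarrow> 0 < s \<Longrightarrow> v \<in> K r s \<Longrightarrow> pairing_contractive pair v f"
        using contractive_functional[OF conjunct1[OF K] nm v_carrier nK] by blast
      have "pairing_contractive pair u f" if "0 < r" "0 < s" "u \<in> S r s" for r s u
        using K that by (intro f(3)[OF that(1,2)]) (auto simp: collection_le_def)
      then have "f \<in> rect_matrix_polar pair S n m" using f(1) nm by (simp add: polar)
      then show False using v f(2) nm by (auto simp: polar_eq)
    qed
  qed
qed

end
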